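(* Assume (H1), and fix $u_i\in\mathcal U$ and $\bar u\in C([0,T];\mathbb R^{n_1})$. Then: (i) $f\mapsto\bar J_i(u_i,f)$ has a unique maximizer $\hat f$ over $L^2(0,T;\mathbb R^n)$; (ii) the system $dx_i=(Ax_i+Bu_i+Gm_i+\gamma p_i)dt+DdW_i$, $\dot m_i=(A+G)m_i+B\bar u+\gamma p_i$, $\dot p_i=-(A+G)^Tp_i-(I-\Gamma)^TQ[\mathbb Ex_i-(\Gamma m_i+\eta)]$, with $x_i(0)$ given, $m_i(0)=m_0$, $p_i(T)=H\,\mathbb Ex_i(T)$, has a unique solution $(x_i,m_i,p_i)\in L^2_{\mathcal F}(0,T;\mathbb R^n)\times L^2(0,T;\mathbb R^{2n})$ (with $m_i,p_i$ deterministic), and $\hat f=\gamma p_i$.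
   Context: Fix integers $n,n_1,n_2\ge1$, $T>0$, constant matrices $A,G,\Gamma\in\mathbb R^{n\times n}$, $B\in\mathbb R^{n\times n_1}$, $D\in\mathbb R^{n\times n_2}$, $\eta,m_0\in\mathbb R^n$, $\gamma>0$, symmetric $Q\ge0$, $H\ge0$ ($n\times n$), $R>0$ ($n_1\times n_1$). Write $|z|_M^2=z^TMz$, $\widehat Q=(I-\Gamma)^TQ(I-\Gamma)$, $\|h\|_{L^2}=(\int_0^T|h|^2dt)^{1/2}$. $W_i$ is an $n_2$-dimensional standard Brownian motion with natural filtration $\{\mathcal F_t\}$, $\mathcal U=L^2_{\mathcal F}(0,T;\mathbb R^{n_1})$. Fix deterministic $x_i(0)\in\mathbb R^n$. For $u_i\in\mathcal U$, $f\in L^2(0,T;\mathbb R^n)$ let $dx_i=(Ax_i+Bu_i+Gm_i+f)dt+DdW_i$, $\dot m_i=(A+G)m_i+B\bar u+f$, $m_i(0)=m_0$, and $\bar J_i(u_i,f)=\mathbb E\int_0^T\{|x_i-(\Gamma m_i+\eta)|_Q^2+u_i^TRu_i-\frac1\gamma|f|^2\}dt+\mathbb E\,x_i(T)^THx_i(T)$. For $g\in L^2(0,T;\mathbb R^n)$ let $\dot z=(A+G)z+g$, $z(0)=0$, $\bar J''(g)=\int_0^T\{-z^T\widehat Qz+\frac1\gamma|g|^2\}dt-z(T)^THz(T)$. (H1): there exists $\epsilon_0>0$ with $\bar J''(g)\ge\epsilon_0\|g\|_{L^2}^2$ for all $g$. *)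

theory Defs
  imports "HOL-Probability.Probability"
begin

definition L2 :: "real \<Rightarrow> (real \<Rightarrow> 'b::euclidean_space) set" where
  "L2 T = {f. f \<in> borel_measurable (restrict_space lborel {0..T}) \<and>
              integrable (restrict_space lborel {0..T}) (\<lambda>t. (norm (f t))^2)}"

definition L2norm2 :: "real \<Rightarrow> (real \<Rightarrow> 'b::euclidean_space) \<Rightarrow> real" where
  "L2norm2 T f = (LINT t:{0..T}|lborel. (norm (f t))^2)"

text \<open>Solution of an ODE  y' = rhs  on [0,T] in integral (absolutely continuous) form;
  rhs is the right-hand side already evaluated along y.\<close>
definition ode_sol :: "real \<Rightarrow> (real \<Rightarrow> 'b::euclidean_space) \<Rightarrow> (real \<Rightarrow> 'b) \<Rightarrow> bool" where
  "ode_sol T rhs y \<longleftrightarrow> set_integrable lborel {0..T} rhs \<and>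
     (\<forall>t\<in>{0..T}. y t = y 0 + (LINT s:{0..t}|lborel. rhs s))"

definition nat_filt :: "'a measure \<Rightarrow> (real \<Rightarrow> 'a \<Rightarrow> real^'d) \<Rightarrow> real \<Rightarrow> 'a measure" where
  "nat_filt M W t = sigma (space M)
     (\<Union>r\<in>{0..t}. {W r -` A \<inter> space M | A. A \<in> sets (borel :: (real^'d) measure)})"


definition std_BM :: "'a measure \<Rightarrow> (real \<Rightarrow> 'a \<Rightarrow> real^'d) \<Rightarrow> bool" where
  "std_BM M W \<longleftrightarrow> prob_space M \<and>
     (\<forall>t\<ge>0. W t \<in> borel_measurable M) \<and>
     (AE \<omega> in M. W 0 \<omega> = 0 \<and> continuous_on {0..} (\<lambda>t. W t \<omega>)) \<and>
     (\<forall>s t. 0 \<le> s \<and> s < t \<longrightarrow>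
        prob_space.indep_set M
           {(\<lambda>\<omega>. W t \<omega> - W s \<omega>) -` A \<inter> space M | A. A \<in> sets (borel :: (real^'d) measure)}
           (sets (nat_filt M W s)) \<and>
        prob_space.indep_vars M (\<lambda>_. borel) (\<lambda>j \<omega>. (W t \<omega> - W s \<omega>) $ j) UNIV \<and>
        (\<forall>j. distributed M lborel (\<lambda>\<omega>. (W t \<omega> - W s \<omega>) $ j)
               (\<lambda>x. ennreal (normal_density 0 (sqrt (t - s)) x))))"

definition L2F :: "'a measure \<Rightarrow> (real \<Rightarrow> 'a \<Rightarrow> real^'d) \<Rightarrow> real \<Rightarrow>
                   (real \<Rightarrow> 'a \<Rightarrow> 'b::euclidean_space) \<Rightarrow> bool" where
  "L2F M W T x \<longleftrightarrow>
     (\<forall>t\<in>{0..T}. (\<lambda>(s,\<omega>). x s \<omega>) \<in>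
         borel_measurable (restrict_space lborel {0..t} \<Otimes>\<^sub>M nat_filt M W t)) \<and>
     integrable (restrict_space lborel {0..T} \<Otimes>\<^sub>M M) (\<lambda>(s,\<omega>). (norm (x s \<omega>))^2)"

text \<open>dx = (Ax + Bu + Gm + f)dt + D dW, x(0) = x0 (the noise is additive with constant D,
  so int_0^t D dW = D W(t)); dm/dt = (A+G)m + B ubar + f, m(0) = m0.\<close>
definition is_state ::
  "'a measure \<Rightarrow> (real \<Rightarrow> 'a \<Rightarrow> real^'n2) \<Rightarrow> real \<Rightarrow>
   real^'n^'n \<Rightarrow> real^'n1^'n \<Rightarrow> real^'n^'n \<Rightarrow> real^'n2^'n \<Rightarrow>
   real^'n \<Rightarrow> real^'n \<Rightarrow> (real \<Rightarrow> 'a \<Rightarrow> real^'n1) \<Rightarrow> (real \<Rightarrow> real^'n1) \<Rightarrow> (real \<Rightarrow> real^'n) \<Rightarrow>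
   (real \<Rightarrow> 'a \<Rightarrow> real^'n) \<Rightarrow> (real \<Rightarrow> real^'n) \<Rightarrow> bool" where
  "is_state M W T A B G D x0 m0 u ubar f x m \<longleftrightarrow>
     ode_sol T (\<lambda>s. (A + G) *v m s + B *v ubar s + f s) m \<and> m 0 = m0 \<and>
     L2F M W T x \<and>
     (AE \<omega> in M.
        set_integrable lborel {0..T} (\<lambda>s. A *v x s \<omega> + B *v u s \<omega> + G *v m s + f s) \<and>
        (\<forall>t\<in>{0..T}. x t \<omega> = x0 + (LINT s:{0..t}|lborel. A *v x s \<omega> + B *v u s \<omega> + G *v m s + f s)
                                 + D *v W t \<omega>))"

text \<open>Cost \<bar>J_i(u_i,f), evaluated along the (unique) state (x_i,m_i).\<close>
definition Jbar ::
  "'a measure \<Rightarrow> (real \<Rightarrow> 'a \<Rightarrow> real^'n2) \<Rightarrow> real \<Rightarrow>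
   real^'n^'n \<Rightarrow> real^'n1^'n \<Rightarrow> real^'n^'n \<Rightarrow> real^'n2^'n \<Rightarrow> real^'n^'n \<Rightarrow>
   real^'n^'n \<Rightarrow> real^'n^'n \<Rightarrow> real^'n1^'n1 \<Rightarrow> real^'n \<Rightarrow> real \<Rightarrow>
   real^'n \<Rightarrow> real^'n \<Rightarrow> (real \<Rightarrow> 'a \<Rightarrow> real^'n1) \<Rightarrow> (real \<Rightarrow> real^'n1) \<Rightarrow> (real \<Rightarrow> real^'n) \<Rightarrow> real" where
  "Jbar M W T A B G D Gam Q H R \<eta> \<gamma> x0 m0 u ubar f =
     (let (x, m) = (SOME (x, m). is_state M W T A B G D x0 m0 u ubar f x m) in
        (\<integral>\<omega>. (LINT t:{0..T}|lborel.
                  (x t \<omega> - (Gam *v m t + \<eta>)) \<bullet> (Q *v (x t \<omega> - (Gam *v m t + \<eta>)))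
                  + u t \<omega> \<bullet> (R *v u t \<omega>) - (1 / \<gamma>) * (norm (f t))^2) \<partial>M)
        + (\<integral>\<omega>. x T \<omega> \<bullet> (H *v x T \<omega>) \<partial>M))"

text \<open>\<bar>J''(g) along z' = (A+G)z + g, z(0) = 0.\<close>
definition Jpp ::
  "real \<Rightarrow> real^'n^'n \<Rightarrow> real^'n^'n \<Rightarrow> real \<Rightarrow>
   (real \<Rightarrow> real^'n) \<Rightarrow> (real \<Rightarrow> real^'n) \<Rightarrow> real" where
  "Jpp T Qhat H \<gamma> g z =
     (LINT t:{0..T}|lborel. - (z t \<bullet> (Qhat *v z t)) + (1 / \<gamma>) * (norm (g t))^2)
     - z T \<bullet> (H *v z T)"

definition H1 :: "real \<Rightarrow> real^'n^'n \<Rightarrow> real^'n^'n \<Rightarrow> real^'n^'n \<Rightarrow> real^'n^'n \<Rightarrow>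
                  real^'n^'n \<Rightarrow> real \<Rightarrow> bool" where
  "H1 T A G Gam Q H \<gamma> \<longleftrightarrow>
     (\<exists>\<epsilon>0>0. \<forall>g\<in>L2 T. \<forall>z. ode_sol T (\<lambda>s. (A + G) *v z s + g s) z \<and> z 0 = 0 \<longrightarrow>
        Jpp T (transpose (mat 1 - Gam) ** Q ** (mat 1 - Gam)) H \<gamma> g z \<ge> \<epsilon>0 * L2norm2 T g)"

definition ham_sol ::
  "'a measure \<Rightarrow> (real \<Rightarrow> 'a \<Rightarrow> real^'n2) \<Rightarrow> real \<Rightarrow>
   real^'n^'n \<Rightarrow> real^'n1^'n \<Rightarrow> real^'n^'n \<Rightarrow> real^'n2^'n \<Rightarrow> real^'n^'n \<Rightarrow>
   real^'n^'n \<Rightarrow> real^'n^'n \<Rightarrow> real^'n \<Rightarrow> real \<Rightarrow>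
   real^'n \<Rightarrow> real^'n \<Rightarrow> (real \<Rightarrow> 'a \<Rightarrow> real^'n1) \<Rightarrow> (real \<Rightarrow> real^'n1) \<Rightarrow>
   (real \<Rightarrow> 'a \<Rightarrow> real^'n) \<Rightarrow> (real \<Rightarrow> real^'n) \<Rightarrow> (real \<Rightarrow> real^'n) \<Rightarrow> bool" where
  "ham_sol M W T A B G D Gam Q H \<eta> \<gamma> x0 m0 u ubar x m p \<longleftrightarrow>
     L2F M W T x \<and> m \<in> L2 T \<and> p \<in> L2 T \<and>
     (AE \<omega> in M.
        set_integrable lborel {0..T} (\<lambda>s. A *v x s \<omega> + B *v u s \<omega> + G *v m s + \<gamma> *\<^sub>R p s) \<and>
        (\<forall>t\<in>{0..T}. x t \<omega> = x0 + (LINT s:{0..t}|lborel. A *v x s \<omega> + B *v u s \<omega> + G *v m s + \<gamma> *\<^sub>R p s)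
                                 + D *v W t \<omega>)) \<and>
     ode_sol T (\<lambda>s. (A + G) *v m s + B *v ubar s + \<gamma> *\<^sub>R p s) m \<and> m 0 = m0 \<and>
     ode_sol T (\<lambda>s. - (transpose (A + G) *v p s)
                    - transpose (mat 1 - Gam) *v (Q *v ((\<integral>\<omega>. x s \<omega> \<partial>M) - (Gam *v m s + \<eta>)))) p \<and>
     p T = H *v (\<integral>\<omega>. x T \<omega> \<partial>M)"

end

theory Submission
  imports Defs
begin

text \<open>Changing the disturbance from \<open>f\<close> to \<open>f + g\<close> shifts both \<open>x\<close> and \<open>m\<close> by the same
  deterministic \<open>z\<close> with \<open>z' = (A + G) z + g\<close>, because \<open>x - m\<close> does not see \<open>g\<close>. Hence the cost is
  quadratic in \<open>g\<close> with second-order part \<open>- J''(g)\<close>, and integrating \<open>p \<bullet> z\<close> by parts shows that the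
  first-order part vanishes at \<open>f = \<gamma> p\<close> whenever \<open>p\<close> solves the adjoint equation. By (H1) every
  solution of the Hamiltonian system therefore yields the strict maximizer \<open>\<gamma> p\<close>, which gives both
  uniqueness claims. Existence avoids completeness of \<open>L\<^sup>2\<close>: relative to the undisturbed state
  the system is a linear boundary value problem for \<open>(z, p)\<close> in finite dimension, which (H1) makes
  uniquely solvable.\<close>

subsection \<open>Linear Volterra equations\<close>

text \<open>Existence of the state is mainly a measurability question: \<open>L2F\<close> asks for
  joint measurability with respect to the raw natural filtration up to every time, whereas the
  equation holds only almost surely. Because the noise is additive, the equation can be read path by
  path as y = k + int L y with the Brownian path inside the forcing k, and variation of constants
  writes y as an explicit formula in k whose ingredients all preserve \<open>L2F\<close>. Since z is
  deterministic, the first variation sees x only through its mean; this is why a deterministic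
  adjoint p suffices. The boundary map is injective for this reason: if z' = (A + G) z + \<gamma> p,
  z(0) = 0, p solves the homogeneous adjoint equation and p(T) = H z(T), then integrating p . z by
  parts gives J''(\<gamma> p) = 0, and coercivity forces p = 0. The maximizer is unique almost
  everywhere, m and p at every time of [0,T], and x up to indistinguishability.\<close>

text \<open>The flow exp(t L) of v' = L v. It is set up for a linear map of any Euclidean space, so
  that one construction serves the state equation on R^n as well as the coupled pair (z, p) on R^n x
  R^n.\<close>

definition propagator :: "('b \<Rightarrow> 'b) \<Rightarrow> real \<Rightarrow> 'b::euclidean_space \<Rightarrow> 'b" where
  "propagator L t v = (\<Sum>k. (t ^ k / fact k) *\<^sub>R (L ^^ k) v)"

lemma norm_funpow_le:
  fixes L :: "'b::real_normed_vector \<Rightarrow> 'b"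
  assumes "\<And>v. norm (L v) \<le> K * norm v" "K \<ge> 0"
  shows "norm ((L ^^ k) v) \<le> K ^ k * norm v"
proof (induction k)
  case (Suc k)
  have "norm ((L ^^ Suc k) v) \<le> K * norm ((L ^^ k) v)"
    using assms(1) by simp
  also have "\<dots> \<le> K * (K ^ k * norm v)"
    using Suc assms(2) by (intro mult_left_mono)
  finally show ?case by simp
qed simp

lemma propagator_summable:
  fixes L :: "'b::euclidean_space \<Rightarrow> 'b"
  assumes "linear L"
  shows "summable (\<lambda>k. (t ^ k / fact k) *\<^sub>R (L ^^ k) v)"
proof -
  obtain K where K: "K > 0" "\<And>v. norm (L v) \<le> K * norm v"
    using linear_bounded_pos[OF assms] by auto
  have "summable (\<lambda>k. norm v * (inverse (fact k) * (\<bar>t\<bar> * K) ^ k))"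
    by (intro summable_mult summable_exp)
  then show ?thesis
  proof (rule summable_comparison_test')
    fix k
    have "norm ((t ^ k / fact k) *\<^sub>R (L ^^ k) v) = \<bar>t\<bar> ^ k / fact k * norm ((L ^^ k) v)"
      by (simp add: power_abs)
    also have "\<dots> \<le> \<bar>t\<bar> ^ k / fact k * (K ^ k * norm v)"
      using norm_funpow_le[of L K k v] K by (intro mult_left_mono) auto
    also have "\<dots> = norm v * (inverse (fact k) * (\<bar>t\<bar> * K) ^ k)"
      by (simp add: power_mult_distrib field_simps)
    finally show "norm ((t ^ k / fact k) *\<^sub>R (L ^^ k) v) \<le> \<dots>" .
  qed
qed

lemma linear_funpow:
  fixes L :: "'b::real_vector \<Rightarrow> 'b"
  shows "linear L \<Longrightarrow> linear (L ^^ k)"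
proof (induction k)
  case (Suc k)
  then show ?case
    using linear_compose[of "L ^^ k" L] by (simp add: o_def)
qed (simp add: linear_id[unfolded id_def] id_def)

lemma propagator_linear:
  fixes L :: "'b::euclidean_space \<Rightarrow> 'b"
  assumes "linear L"
  shows "linear (propagator L t)"
proof (rule linearI)
  note s = propagator_summable[OF assms]
  show "propagator L t (x + y) = propagator L t x + propagator L t y" for x y
    by (simp add: propagator_def linear_add[OF linear_funpow[OF assms]] scaleR_right_distrib
        suminf_add[OF s s, symmetric])
  show "propagator L t (c *\<^sub>R x) = c *\<^sub>R propagator L t x" for c x
    unfolding propagator_def
    by (subst suminf_scaleR_right[OF s])
      (simp add: linear_scale[OF linear_funpow[OF assms]] mult.commute)
qed

lemma propagator_commute:
  fixes L :: "'b::euclidean_space \<Rightarrow> 'b"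
  assumes "linear L"
  shows "propagator L t (L v) = L (propagator L t v)"
proof -
  have "L (propagator L t v) = (\<Sum>k. L ((t ^ k / fact k) *\<^sub>R (L ^^ k) v))"
    unfolding propagator_def
    by (rule bounded_linear.suminf[OF linear_conv_bounded_linear[THEN iffD1, OF assms] 
          propagator_summable[OF assms]])
  then show ?thesis
    by (simp add: propagator_def linear_scale[OF assms] funpow_swap1)
qed

lemma propagator_0: "propagator L 0 v = v"
proof -
  have "(\<lambda>k. (0 ^ k / fact k) *\<^sub>R (L ^^ k) v) sums ((0 ^ 0 / fact 0) *\<^sub>R (L ^^ 0) v)"
    using sums_finite[of "{0}" "\<lambda>k. (0 ^ k / fact k) *\<^sub>R (L ^^ k) v"] by simp
  then show ?thesis
    unfolding propagator_def by (simp add: sums_iff)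
qed

text \<open>Each coordinate is a scalar power series, which may be differentiated termwise; the
  differentiated coefficients carry \<open>L ^^ Suc k\<close>, that is, they form the series at
  \<open>L v\<close>.\<close>

lemma propagator_has_vector_derivative:
  fixes L :: "'b::euclidean_space \<Rightarrow> 'b"
  assumes "linear L"
  shows "((\<lambda>t. propagator L t v) has_vector_derivative L (propagator L t v)) (at t)"
proof -
  note s = propagator_summable[OF assms]
  let ?c = "\<lambda>b k. ((L ^^ k) v \<bullet> b) / fact k"
  have inner: "propagator L t w \<bullet> b = (\<Sum>k. ((L ^^ k) w \<bullet> b) / fact k * t ^ k)" for t w b
    unfolding propagator_def
    by (subst bounded_linear.suminf[OF bounded_linear_inner_left s]) (simp add: field_simps)
  have sb: "summable (\<lambda>k. ?c b k * t ^ k)" for b t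
    using bounded_linear.summable[OF bounded_linear_inner_left s[of t v], of b]
    by (simp add: field_simps)
  have "((\<lambda>t. propagator L t v \<bullet> b) has_field_derivative L (propagator L t v) \<bullet> b) (at t)" for b
  proof -
    have "diffs (?c b) = (\<lambda>k. ((L ^^ k) (L v) \<bullet> b) / fact k)"
      by (auto simp: diffs_def fun_eq_iff funpow_swap1)
    then show ?thesis
      using termdiffs_strong_converges_everywhere[OF sb, of b t]
      by (simp add: inner propagator_commute[OF assms, symmetric])
  qed
  then show ?thesis
    unfolding has_vector_derivative_def
    by (subst has_derivative_componentwise_within)
      (auto simp: has_field_derivative_def mult.commute[of "_ \<bullet> _"] mult_commute_abs)
qed

text \<open>Separates time from the vector: questions about exp(t L) w(t) with both arguments moving
  (product rule, joint continuity, uniform bounds) reduce to the finitely many curves t -> exp(t L)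
  b.\<close>

lemma propagator_expand:
  fixes L :: "'b::euclidean_space \<Rightarrow> 'b"
  assumes "linear L"
  shows "propagator L t v = (\<Sum>b\<in>Basis. (v \<bullet> b) *\<^sub>R propagator L t b)"
  using linear_sum[OF propagator_linear[OF assms], of t "\<lambda>b. (v \<bullet> b) *\<^sub>R b" Basis]
  by (simp add: euclidean_representation linear_scale[OF propagator_linear[OF assms]])

lemma propagator_product_rule:
  fixes L :: "'b::euclidean_space \<Rightarrow> 'b"
  assumes L: "linear L" and w: "(w has_vector_derivative w') (at t within S)"
  shows "((\<lambda>t. propagator L t (w t)) has_vector_derivative
            propagator L t w' + L (propagator L t (w t))) (at t within S)"
proof -
  have "((\<lambda>t. \<Sum>b\<in>Basis. (w t \<bullet> b) *\<^sub>R propagator L t b) has_vector_derivative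
     (\<Sum>b\<in>Basis. (w t \<bullet> b) *\<^sub>R L (propagator L t b) + (w' \<bullet> b) *\<^sub>R propagator L t b)) (at t within S)"
    by (intro has_vector_derivative_sum has_vector_derivative_scaleR
        has_vector_derivative_at_within[OF propagator_has_vector_derivative[OF L]]
        bounded_linear.has_vector_derivative[OF bounded_linear_inner_left w, folded has_real_derivative_iff_has_vector_derivative])
  moreover have "(\<Sum>b\<in>Basis. (w t \<bullet> b) *\<^sub>R L (propagator L t b)) = L (propagator L t (w t))"
    by (subst propagator_expand[OF L, of t "w t"]) (simp add: linear_sum[OF L] linear_scale[OF L])
  ultimately show ?thesis
    by (simp add: sum.distrib flip: propagator_expand[OF L])
      (simp add: add.commute)
qed

text \<open>By the product rule exp(t L) exp(- t L) v has derivative zero, so it keeps its value at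
  t = 0. No multiplication of series is involved.\<close>

lemma propagator_cancel:
  fixes L :: "'b::euclidean_space \<Rightarrow> 'b"
  assumes L: "linear L"
  shows "propagator L t (propagator L (- t) v) = v"
proof -
  have 1: "((\<lambda>t. propagator L (- t) v) has_vector_derivative - L (propagator L (- t) v)) (at t)" for t
    using vector_diff_chain_at[OF has_vector_derivative_minus[OF has_vector_derivative_id]
       propagator_has_vector_derivative[OF L, of v "- t"]]
    by (simp add: o_def)
  have "((\<lambda>t. propagator L t (propagator L (- t) v)) has_vector_derivative 0) (at t)" for t
    using propagator_product_rule[OF L 1, of t]
    by (simp add: linear_neg[OF propagator_linear[OF L]] propagator_commute[OF L])
  then obtain c where "\<And>t. propagator L t (propagator L (- t) v) = c"
    using has_vector_derivative_zero_constant[of UNIV "\<lambda>t. propagator L t (propagator L (- t) v)"] 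
    by auto
  then show ?thesis
    by (metis propagator_0 minus_zero)
qed

lemma propagator_continuous:
  fixes L :: "'b::euclidean_space \<Rightarrow> 'b"
  assumes L: "linear L" and f: "continuous_on S f" and w: "continuous_on S w"
  shows "continuous_on S (\<lambda>x. propagator L (f x) (w x))"
proof -
  have "continuous_on UNIV (\<lambda>t. propagator L t b)" for b
    by (intro continuous_at_imp_continuous_on ballI
        has_vector_derivative_continuous[OF propagator_has_vector_derivative[OF L]])
  then have "continuous_on S (\<lambda>x. propagator L (f x) b)" for b
    using continuous_on_compose2[OF _ f] by blast
  then show ?thesis
    by (subst propagator_expand[OF L]) (intro continuous_intros w)
qed

section \<open>Indefinite integrals on [0,T] and the Volterra equation\<close>

lemma LINT_has_vector_derivative:
  fixes g :: "real \<Rightarrow> 'b::euclidean_space"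
  assumes "continuous_on {0..T} g" "t \<in> {0..T}"
  shows "((\<lambda>t. LINT s:{0..t}|lborel. g s) has_vector_derivative g t) (at t within {0..T})"
proof -
  have eq: "(LINT s:{0..t}|lborel. g s) = integral {0..t} g" if "t \<in> {0..T}" for t
    using that by (intro set_borel_integral_eq_integral borel_integrable_atLeastAtMost'
        continuous_on_subset[OF assms(1)]) auto
  show ?thesis
    by (rule has_vector_derivative_transform[OF assms(2) _
          integral_has_vector_derivative[OF assms]]) (simp add: eq)
qed

lemma LINT_eq_diff:
  fixes y :: "real \<Rightarrow> 'b::euclidean_space"
  assumes d: "\<And>t. t \<in> {0..T} \<Longrightarrow> (y has_vector_derivative y' t) (at t within {0..T})"
    and c: "continuous_on {0..T} y'" and t: "t \<in> {0..T}"
  shows "(LINT s:{0..t}|lborel. y' s) = y t - y 0"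
proof -
  have "(LINT s:{0..t}|lborel. y' s) = integral {0..t} y'"
    using t by (intro set_borel_integral_eq_integral borel_integrable_atLeastAtMost'
        continuous_on_subset[OF c]) auto
  also have "(y' has_integral y t - y 0) {0..t}"
    using t by (intro fundamental_theorem_of_calculus has_vector_derivative_within_subset[OF d]) auto
  then have "integral {0..t} y' = y t - y 0"
    by (rule integral_unique)
  finally show ?thesis .
qed

lemma LINT_singleton:
  fixes g :: "real \<Rightarrow> 'b::euclidean_space"
  shows "(LINT s:{a}|lborel. g s) = 0"
proof -
  have "AE s in lborel. indicator {a} s *\<^sub>R g s = 0"
    using AE_lborel_singleton[of a] by eventually_elim auto
  then show ?thesis
    unfolding set_lebesgue_integral_def by (rule integral_eq_zero_AE)
qed

lemma continuous_on_LINT: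
  fixes g :: "real \<Rightarrow> 'b::euclidean_space"
  assumes "set_integrable lborel {0..T} g"
  shows "continuous_on {0..T} (\<lambda>t. LINT s:{0..t}|lborel. g s)"
proof -
  have "(LINT s:{0..t}|lborel. g s) = integral {0..t} g" if "t \<in> {0..T}" for t
    using that by (intro set_borel_integral_eq_integral set_integrable_subset[OF assms]) auto
  then show ?thesis
    using indefinite_integral_continuous_1[OF set_borel_integral_eq_integral(1)[OF assms]]
    by (subst continuous_on_cong[OF refl]) auto
qed

text \<open>With \<open>w' = L w + k\<close>, \<open>w 0 = 0\<close>, the derivative \<open>y = w' = k + L w\<close> satisfies
  \<open>y = k + \<integral> L y\<close>; this needs only continuity of the forcing \<open>k\<close>.\<close>
definition volterra :: "('b \<Rightarrow> 'b) \<Rightarrow> (real \<Rightarrow> 'b) \<Rightarrow> real \<Rightarrow> 'b::euclidean_space" where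
  "volterra L k t = k t + L (propagator L t (LINT s:{0..t}|lborel. propagator L (- s) (k s)))"

text \<open>Variation of constants: for w(t) = exp(t L) int_0^t exp(- s L) k(s) ds the product rule
  and exp(t L) exp(- t L) = 1 give w' = k + L w, which is \<open>volterra L k\<close> itself.
  Integrating L w' from w(0) = 0 yields L w, the difference between \<open>volterra L k\<close> and
  k.\<close>

lemma
  fixes L :: "'b::euclidean_space \<Rightarrow> 'b"
  assumes L: "linear L" and k: "continuous_on {0..T} k"
  shows volterra_continuous: "continuous_on {0..T} (volterra L k)"
    and volterra_solves: "t \<in> {0..T} \<Longrightarrow> volterra L k t = k t + (LINT s:{0..t}|lborel. L (volterra L k s))"
proof -
  note BL = L[unfolded linear_conv_bounded_linear]
  define w where "w t = propagator L t (LINT s:{0..t}|lborel. propagator L (- s) (k s))" for t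
  have v: "volterra L k = (\<lambda>t. k t + L (w t))"
    by (simp add: volterra_def w_def fun_eq_iff)
  have w': "(w has_vector_derivative volterra L k t) (at t within {0..T})" if "t \<in> {0..T}" for t
    using propagator_product_rule[OF L LINT_has_vector_derivative[OF 
        propagator_continuous[OF L continuous_on_minus[OF continuous_on_id] k] that]]
    unfolding w_def[symmetric] v by (simp add: propagator_cancel[OF L])
  then have wc: "continuous_on {0..T} w"
    by (meson has_vector_derivative_continuous continuous_on_eq_continuous_within)
  show c: "continuous_on {0..T} (volterra L k)"
    unfolding v by (intro continuous_intros k bounded_linear.continuous_on[OF BL] wc)
  have w0: "w 0 = 0"
    by (simp add: w_def propagator_0 LINT_singleton)
  show "volterra L k t = k t + (LINT s:{0..t}|lborel. L (volterra L k s))" if "t \<in> {0..T}"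
  proof -
    have "(LINT s:{0..t}|lborel. L (volterra L k s)) = L (w t) - L (w 0)"
      by (rule LINT_eq_diff[OF _ _ that])
        (auto intro!: bounded_linear.continuous_on[OF BL] c bounded_linear.has_vector_derivative[OF BL] w')
    then show ?thesis
      by (simp add: w0 v linear_0[OF L])
  qed
qed

text \<open>Regularity is bootstrapped from the integral equation: an indefinite integral is
  continuous, hence the integrand \<open>L (d s)\<close> is continuous, hence \<open>d\<close> is
  differentiable.\<close>

lemma volterra_homogeneous_zero:
  fixes L :: "'b::euclidean_space \<Rightarrow> 'b" and d :: "real \<Rightarrow> 'b"
  assumes L: "linear L" and i: "set_integrable lborel {0..T} (\<lambda>s. L (d s))"
    and d: "\<And>t. t \<in> {0..T} \<Longrightarrow> d t = (LINT s:{0..t}|lborel. L (d s))"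
    and t: "t \<in> {0..T}"
  shows "d t = 0"
proof -
  note BL = L[unfolded linear_conv_bounded_linear]
  have c: "continuous_on {0..T} d"
    using continuous_on_LINT[OF i] by (subst continuous_on_cong[OF refl d]) auto
  have d': "(d has_vector_derivative L (d t)) (at t within {0..T})" if "t \<in> {0..T}" for t
    by (rule has_vector_derivative_transform[OF that d
          LINT_has_vector_derivative[OF bounded_linear.continuous_on[OF BL c] that]])
  \<comment> \<open>The integrating factor: \<open>propagator N t\<close> is exp(- t L), and exp(- t
    L) d(t) has derivative zero.\<close>
  define N where "N v = - L v" for v
  have N: "linear N"
    unfolding N_def by (intro linear_compose_neg L)
  have "((\<lambda>t. propagator N t (d t)) has_vector_derivative 0) (at t within {0..T})" if "t \<in> {0..T}" for t
  proof -
    have "propagator N t (L (d t)) = - propagator N t (N (d t))"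
      by (simp add: N_def linear_neg[OF propagator_linear[OF N]])
    then show ?thesis
      using propagator_product_rule[OF N d'[OF that]] by (simp add: propagator_commute[OF N])
  qed
  then obtain e where e: "\<And>t. t \<in> {0..T} \<Longrightarrow> propagator N t (d t) = e"
    using has_vector_derivative_zero_constant[of "{0..T}" "\<lambda>t. propagator N t (d t)"] by auto
  have "d 0 = 0"
    using t by (subst d) (auto simp: LINT_singleton)
  then have "e = 0"
    using e[of 0] t by (simp add: linear_0[OF propagator_linear[OF N]])
  then show ?thesis
    using e[OF t] propagator_cancel[OF N, of "- t" "d t"] by (simp add: linear_0[OF propagator_linear[OF N]])
qed

text \<open>The forcing is split in two: \<open>c\<close> may be any function, such as a Brownian
  path, and \<open>h\<close> stands under the integral. Only the whole integrand
  \<open>L (y s) + h s\<close> is assumed integrable, so the two integrands are subtracted as wholes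
  and both \<open>c\<close> and \<open>h\<close> cancel.\<close>

lemma volterra_unique:
  fixes L :: "'b::euclidean_space \<Rightarrow> 'b" and y y' :: "real \<Rightarrow> 'b"
  assumes L: "linear L"
    and i: "set_integrable lborel {0..T} (\<lambda>s. L (y s) + h s)" "set_integrable lborel {0..T} (\<lambda>s. L (y' s) + h s)"
    and y: "\<And>t. t \<in> {0..T} \<Longrightarrow> y t = c t + (LINT s:{0..t}|lborel. L (y s) + h s)"
    and y': "\<And>t. t \<in> {0..T} \<Longrightarrow> y' t = c t + (LINT s:{0..t}|lborel. L (y' s) + h s)"
    and t: "t \<in> {0..T}"
  shows "y' t = y t"
proof -
  have "y' t - y t = 0"
  proof (rule volterra_homogeneous_zero[OF L _ _ t, of "\<lambda>t. y' t - y t"])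
    have eq: "L (y' s - y s) = (L (y' s) + h s) - (L (y s) + h s)" for s
      by (simp add: linear_diff[OF L])
    show "set_integrable lborel {0..T} (\<lambda>s. L (y' s - y s))"
      unfolding eq by (intro set_integral_diff i)
    show "y' t - y t = (LINT s:{0..t}|lborel. L (y' s - y s))" if "t \<in> {0..T}" for t
    proof -
      have "set_integrable lborel {0..t} (\<lambda>s. L (y s) + h s)" "set_integrable lborel {0..t} (\<lambda>s. L (y' s) + h s)"
        using that by (auto intro!: set_integrable_subset[OF i(1)] set_integrable_subset[OF i(2)])
      then show ?thesis
        unfolding eq by (subst set_integral_diff(2)) (auto simp: y[OF that] y'[OF that])
    qed
  qed
  then show ?thesis by simp
qed

subsection \<open>Progressively measurable square-integrable processes\<close>

abbreviation leb :: "real \<Rightarrow> real measure" where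
  "leb t \<equiv> restrict_space lborel {0..t}"

lemma finite_measure_leb: "finite_measure (leb t)"
  by (rule finite_measureI) (simp add: emeasure_restrict_space space_restrict_space emeasure_lborel_Icc_eq)

lemma sigma_finite_leb: "sigma_finite_measure (leb t)"
  using finite_measure_leb by (simp add: finite_measure_def)

lemma space_leb [simp]: "space (leb t) = {0..t}"
  by (simp add: space_restrict_space)

lemma LINT_leb: "(LINT s:{0..t}|lborel. f s) = integral\<^sup>L (leb t) f"
  for f :: "real \<Rightarrow> 'b::euclidean_space"
  by (simp add: set_lebesgue_integral_def integral_restrict_space)

lemma set_integrable_leb: "set_integrable lborel {0..t} f \<longleftrightarrow> integrable (leb t) f"
  for f :: "real \<Rightarrow> 'b::euclidean_space"
  by (simp add: set_integrable_def integrable_restrict_space)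

lemma measurable_leb_ident: "(\<lambda>x. x) \<in> leb t \<rightarrow>\<^sub>M borel"
  by (rule measurable_restrict_space1) simp

lemma measurable_leb_subset:
  assumes "s \<le> t" "f \<in> borel_measurable (leb t)"
  shows "f \<in> borel_measurable (leb s)"
proof -
  have "leb s = restrict_space (leb t) {0..s}"
    using assms(1) by (subst restrict_restrict_space) (auto simp: Int_absorb1)
  then show ?thesis
    using measurable_restrict_space1[OF assms(2)] by simp
qed

lemma integrable_leb_continuous:
  fixes f :: "real \<Rightarrow> 'b::euclidean_space"
  shows "continuous_on {0..T} f \<Longrightarrow> integrable (leb T) f"
  unfolding set_integrable_leb[symmetric] by (rule borel_integrable_atLeastAtMost')

section \<open>Square-integrable functions of time\<close>

lemma L2_measurable: "f \<in> L2 T \<Longrightarrow> f \<in> borel_measurable (leb T)"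
  and L2_square: "f \<in> L2 T \<Longrightarrow> integrable (leb T) (\<lambda>t. (norm (f t))\<^sup>2)"
  by (auto simp: L2_def)

lemma L2_continuous: "continuous_on {0..T} f \<Longrightarrow> f \<in> L2 T"
  unfolding L2_def mem_Collect_eq
  by (intro conjI borel_measurable_integrable integrable_leb_continuous continuous_intros)

lemma norm_add_square_le:
  fixes a b :: "'b::real_normed_vector"
  shows "(norm (a + b))\<^sup>2 \<le> 2 * (norm a)\<^sup>2 + 2 * (norm b)\<^sup>2"
proof -
  have "(norm (a + b))\<^sup>2 \<le> (norm a + norm b)\<^sup>2"
    by (intro power_mono norm_triangle_ineq) simp
  also have "\<dots> \<le> 2 * (norm a)\<^sup>2 + 2 * (norm b)\<^sup>2"
    using sum_squares_bound[of "norm a" "norm b"] by (simp add: power2_sum)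
  finally show ?thesis .
qed

lemma integrable_inner_square:
  fixes f g :: "'c \<Rightarrow> 'b::euclidean_space"
  assumes [measurable]: "f \<in> borel_measurable N" "g \<in> borel_measurable N"
    and "integrable N (\<lambda>x. (norm (f x))\<^sup>2)" "integrable N (\<lambda>x. (norm (g x))\<^sup>2)"
  shows "integrable N (\<lambda>x. f x \<bullet> g x)"
proof (rule Bochner_Integration.integrable_bound)
  show "integrable N (\<lambda>x. (norm (f x))\<^sup>2 + (norm (g x))\<^sup>2)"
    by (intro Bochner_Integration.integrable_add assms)
  show "AE x in N. norm (f x \<bullet> g x) \<le> norm ((norm (f x))\<^sup>2 + (norm (g x))\<^sup>2)"
  proof (rule AE_I2)
    fix x
    have "0 \<le> norm (f x) * norm (g x)"
      by simp
    then have "\<bar>f x \<bullet> g x\<bar> \<le> (norm (f x))\<^sup>2 + (norm (g x))\<^sup>2"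
      using Cauchy_Schwarz_ineq2[of "f x" "g x"] sum_squares_bound[of "norm (f x)" "norm (g x)"] by linarith
    then show "norm (f x \<bullet> g x) \<le> norm ((norm (f x))\<^sup>2 + (norm (g x))\<^sup>2)"
      unfolding real_norm_def by linarith
  qed
qed measurable

lemma integrable_of_square:
  fixes f :: "'c \<Rightarrow> 'b::euclidean_space"
  assumes "finite_measure N" and [measurable]: "f \<in> borel_measurable N"
    and "integrable N (\<lambda>x. (norm (f x))\<^sup>2)"
  shows "integrable N f"
proof -
  have "integrable N (\<lambda>x. norm (f x))"
    by (rule finite_measure.square_integrable_imp_integrable[OF assms(1) _ assms(3)]) measurable
  then show ?thesis
    by (rule integrable_norm_iff[OF assms(2), THEN iffD1])
qed

lemma L2_integrable: "f \<in> L2 T \<Longrightarrow> integrable (leb T) f"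
  using integrable_of_square[OF finite_measure_leb L2_measurable L2_square] .

lemma L2_add:
  assumes "f \<in> L2 T" "g \<in> L2 T"
  shows "(\<lambda>t. f t + g t) \<in> L2 T"
proof -
  note [measurable] = L2_measurable[OF assms(1)] L2_measurable[OF assms(2)]
  have "integrable (leb T) (\<lambda>t. (norm (f t + g t))\<^sup>2)"
  proof (rule Bochner_Integration.integrable_bound)
    show "integrable (leb T) (\<lambda>t. 2 * (norm (f t))\<^sup>2 + 2 * (norm (g t))\<^sup>2)"
      using L2_square[OF assms(1)] L2_square[OF assms(2)] by auto
  qed (simp_all add: norm_add_square_le)
  then show ?thesis by (simp add: L2_def)
qed

lemma L2_bounded_linear:
  assumes "f \<in> L2 T" "linear h"
  shows "(\<lambda>t. h (f t)) \<in> L2 T"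
proof -
  obtain K where K: "K > 0" "\<And>v. norm (h v) \<le> K * norm v"
    using linear_bounded_pos[OF assms(2)] by auto
  note [measurable] = L2_measurable[OF assms(1)]
  have [measurable]: "h \<in> borel_measurable borel"
    using assms(2) by (intro borel_measurable_continuous_onI linear_continuous_on)
      (simp add: linear_conv_bounded_linear)
  have "integrable (leb T) (\<lambda>t. (norm (h (f t)))\<^sup>2)"
  proof (rule Bochner_Integration.integrable_bound)
    show "integrable (leb T) (\<lambda>t. K\<^sup>2 * (norm (f t))\<^sup>2)"
      using L2_square[OF assms(1)] by auto
    show "AE x in leb T. norm ((norm (h (f x)))\<^sup>2) \<le> norm (K\<^sup>2 * (norm (f x))\<^sup>2)"
      using power_mono[OF K(2) norm_ge_zero, of _ 2] by (auto simp: power_mult_distrib)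
  qed simp
  then show ?thesis by (simp add: L2_def)
qed

section \<open>Brownian motion, its natural filtration and progressive processes\<close>

locale brownian =
  fixes M :: "'a measure" and W :: "real \<Rightarrow> 'a \<Rightarrow> real^'d" and T :: real
  assumes BM: "std_BM M W" and T_pos: "T > 0"

sublocale brownian \<subseteq> prob_space M
  using BM by (simp add: std_BM_def)

context brownian
begin

lemma W_measurable: "0 \<le> t \<Longrightarrow> W t \<in> borel_measurable M"
  using BM by (auto simp: std_BM_def)

lemma W_AE: "AE \<omega> in M. W 0 \<omega> = 0 \<and> continuous_on {0..} (\<lambda>t. W t \<omega>)"
  using BM by (auto simp: std_BM_def)

lemma space_nat_filt [simp]: "space (nat_filt M W t) = space M"
  by (auto simp: nat_filt_def intro!: space_measure_of)

lemma sets_nat_filt_subset: "sets (nat_filt M W t) \<subseteq> sets M"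
  unfolding nat_filt_def
  by (subst sets_measure_of) (auto intro!: sets.sigma_sets_subset measurable_sets[OF W_measurable])

lemma nat_filt_ident: "(\<lambda>\<omega>. \<omega>) \<in> M \<rightarrow>\<^sub>M nat_filt M W t"
  using sets_nat_filt_subset by (auto simp: measurable_def)

lemma W_nat_filt_measurable:
  assumes "0 \<le> r" "r \<le> t"
  shows "W r \<in> borel_measurable (nat_filt M W t)"
proof (rule measurableI)
  fix A :: "(real^'d) set" assume A: "A \<in> sets borel"
  show "W r -` A \<inter> space (nat_filt M W t) \<in> sets (nat_filt M W t)"
    unfolding space_nat_filt unfolding nat_filt_def
  proof (rule in_measure_of)
    show "W r -` A \<inter> space M \<in> (\<Union>r\<in>{0..t}. {W r -` A \<inter> space M |A. A \<in> sets borel})"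
      using assms A by (intro UN_I[of r]) auto
  qed auto
qed simp

text \<open>The measurability half of \<open>L2F\<close>, kept separate because it survives pathwise
  integration without any integrability.\<close>

definition progressive :: "(real \<Rightarrow> 'a \<Rightarrow> 'b::euclidean_space) \<Rightarrow> bool" where
  "progressive x \<longleftrightarrow> (\<forall>t\<in>{0..T}. case_prod x \<in> borel_measurable (leb t \<Otimes>\<^sub>M nat_filt M W t))"

lemma L2F_iff: "L2F M W T x \<longleftrightarrow>
    progressive x \<and> integrable (leb T \<Otimes>\<^sub>M M) (\<lambda>(s, \<omega>). (norm (x s \<omega>))\<^sup>2)"
  by (simp add: L2F_def progressive_def)

lemma progressiveD: "progressive x \<Longrightarrow> t \<in> {0..T} \<Longrightarrow>
    case_prod x \<in> borel_measurable (leb t \<Otimes>\<^sub>M nat_filt M W t)"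
  by (simp add: progressive_def)

lemma progressive_measurable:
  assumes "progressive x"
  shows "case_prod x \<in> borel_measurable (leb T \<Otimes>\<^sub>M M)"
proof -
  have "(\<lambda>z. (fst z, snd z)) \<in> leb T \<Otimes>\<^sub>M M \<rightarrow>\<^sub>M leb T \<Otimes>\<^sub>M nat_filt M W T"
    by (intro measurable_Pair measurable_fst measurable_compose[OF measurable_snd nat_filt_ident])
  then show ?thesis
    using measurable_compose[OF _ progressiveD[OF assms, of T]] T_pos by auto
qed

lemma progressive_time:
  assumes "progressive x" "t \<in> {0..T}"
  shows "x t \<in> borel_measurable M"
  using measurable_compose[OF measurable_Pair1'[of t "leb T" M] progressive_measurable[OF assms(1)]] assms(2)
  by simp

lemma progressive_path:
  assumes "progressive x" "\<omega> \<in> space M"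
  shows "(\<lambda>t. x t \<omega>) \<in> borel_measurable (leb T)"
  using measurable_compose[OF measurable_Pair2'[of \<omega> M "leb T"] progressive_measurable[OF assms(1)]] assms(2)
  by simp

lemma L2F_measurable: "L2F M W T x \<Longrightarrow> case_prod x \<in> borel_measurable (leb T \<Otimes>\<^sub>M M)"
  by (simp add: L2F_iff progressive_measurable)

lemma L2F_dominated:
  assumes "progressive x" "integrable (leb T \<Otimes>\<^sub>M M) g"
    and "\<And>s \<omega>. s \<in> {0..T} \<Longrightarrow> \<omega> \<in> space M \<Longrightarrow> (norm (x s \<omega>))\<^sup>2 \<le> g (s, \<omega>)"
  shows "L2F M W T x"
proof -
  note [measurable] = progressive_measurable[OF assms(1)]
  have "integrable (leb T \<Otimes>\<^sub>M M) (\<lambda>(s, \<omega>). (norm (x s \<omega>))\<^sup>2)"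
  proof (rule Bochner_Integration.integrable_bound[OF assms(2)])
    show "AE z in leb T \<Otimes>\<^sub>M M. norm (case z of (s, \<omega>) \<Rightarrow> (norm (x s \<omega>))\<^sup>2) \<le> norm (g z)"
      using assms(3) by (intro AE_I2) (fastforce simp: space_pair_measure)
  qed measurable
  then show ?thesis
    using assms(1) by (simp add: L2F_iff)
qed

text \<open>The map may depend on time so that it covers \<open>propagator L t\<close> and
  \<open>propagator L (- t)\<close>; the growth constant has to be uniform in t.\<close>

lemma L2F_map:
  fixes \<phi> :: "real \<Rightarrow> 'b::euclidean_space \<Rightarrow> 'c::euclidean_space"
  assumes x: "L2F M W T x" and [measurable]: "case_prod \<phi> \<in> borel_measurable (borel \<Otimes>\<^sub>M borel)"
    and C: "\<And>t v. t \<in> {0..T} \<Longrightarrow> norm (\<phi> t v) \<le> C * norm v"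
  shows "L2F M W T (\<lambda>t \<omega>. \<phi> t (x t \<omega>))"
proof (rule L2F_dominated)
  show "progressive (\<lambda>t \<omega>. \<phi> t (x t \<omega>))"
    unfolding progressive_def
  proof
    fix t assume "t \<in> {0..T}"
    then have [measurable]: "case_prod x \<in> borel_measurable (leb t \<Otimes>\<^sub>M nat_filt M W t)"
      using x by (simp add: L2F_iff progressiveD)
    show "(\<lambda>(t, \<omega>). \<phi> t (x t \<omega>)) \<in> borel_measurable (leb t \<Otimes>\<^sub>M nat_filt M W t)"
      using measurable_leb_ident[measurable] by measurable
  qed
  show "integrable (leb T \<Otimes>\<^sub>M M) (\<lambda>z. C\<^sup>2 * (\<lambda>(s, \<omega>). (norm (x s \<omega>))\<^sup>2) z)"
    using x by (simp add: L2F_iff)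
  show "(norm (\<phi> s (x s \<omega>)))\<^sup>2 \<le> C\<^sup>2 * (case (s, \<omega>) of (s, \<omega>) \<Rightarrow> (norm (x s \<omega>))\<^sup>2)" if "s \<in> {0..T}" for s \<omega>
    using power_mono[OF C[OF that] norm_ge_zero, of _ 2] by (simp add: power_mult_distrib)
qed

lemma L2F_linear:
  fixes h :: "'b::euclidean_space \<Rightarrow> 'c::euclidean_space"
  assumes x: "L2F M W T x" and h: "linear h"
  shows "L2F M W T (\<lambda>t \<omega>. h (x t \<omega>))"
proof -
  obtain K where K: "\<And>v. norm (h v) \<le> K * norm v"
    using linear_bounded_pos[OF h] by auto
  have [measurable]: "h \<in> borel_measurable borel"
    using h by (intro borel_measurable_continuous_onI linear_continuous_on)
      (simp add: linear_conv_bounded_linear)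
  show ?thesis
    by (rule L2F_map[OF x _ K]) measurable
qed

lemma L2F_add:
  assumes x: "L2F M W T x" and y: "L2F M W T y"
  shows "L2F M W T (\<lambda>t \<omega>. x t \<omega> + y t \<omega>)"
proof (rule L2F_dominated)
  show "progressive (\<lambda>t \<omega>. x t \<omega> + y t \<omega>)"
    unfolding progressive_def
  proof
    fix t assume "t \<in> {0..T}"
    then have [measurable]: "case_prod x \<in> borel_measurable (leb t \<Otimes>\<^sub>M nat_filt M W t)"
      "case_prod y \<in> borel_measurable (leb t \<Otimes>\<^sub>M nat_filt M W t)"
      using x y by (simp_all add: L2F_iff progressiveD)
    show "(\<lambda>(t, \<omega>). x t \<omega> + y t \<omega>) \<in> borel_measurable (leb t \<Otimes>\<^sub>M nat_filt M W t)"
      by measurable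
  qed
  show "integrable (leb T \<Otimes>\<^sub>M M) (\<lambda>z. 2 * (\<lambda>(s, \<omega>). (norm (x s \<omega>))\<^sup>2) z + 2 * (\<lambda>(s, \<omega>). (norm (y s \<omega>))\<^sup>2) z)"
    using x y by (simp add: L2F_iff)
qed (simp add: norm_add_square_le)

lemma pair_sigma_finite_leb: "pair_sigma_finite (leb T) M"
  by (simp add: pair_sigma_finite_def sigma_finite_leb sigma_finite_measure_axioms)

lemma integrable_pair_time:
  fixes g :: "real \<Rightarrow> 'b::euclidean_space"
  assumes "integrable (leb T) g"
  shows "integrable (leb T \<Otimes>\<^sub>M M) (\<lambda>(s, \<omega>). g s)"
proof -
  interpret P: pair_sigma_finite "leb T" M by (rule pair_sigma_finite_leb)
  have [measurable]: "g \<in> borel_measurable (leb T)"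
    using assms by simp
  show ?thesis
    by (rule P.Fubini_integrable) (use assms in \<open>auto simp: prob_space\<close>)
qed

lemma L2F_deterministic:
  assumes c: "c \<in> L2 T"
  shows "L2F M W T (\<lambda>t \<omega>. c t)"
proof -
  have "progressive (\<lambda>t \<omega>. c t)"
    unfolding progressive_def
  proof
    fix t assume "t \<in> {0..T}"
    then have [measurable]: "c \<in> borel_measurable (leb t)"
      by (intro measurable_leb_subset[OF _ L2_measurable[OF c]]) auto
    show "(\<lambda>(t, \<omega>). c t) \<in> borel_measurable (leb t \<Otimes>\<^sub>M nat_filt M W t)"
      by measurable
  qed
  then show ?thesis
    using integrable_pair_time[OF L2_square[OF c]] by (simp add: L2F_iff)
qed

text \<open>The moving upper limit s <= t becomes the jointly measurable factor
  \<open>indicator {0..s} r\<close> in an integral over the fixed interval [0,t]. Only values of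
  \<open>x\<close> up to time t occur, so measurability with respect to the filtration at t is
  enough.\<close>

lemma progressive_LINT:
  assumes x: "progressive x"
  shows "progressive (\<lambda>t \<omega>. LINT s:{0..t}|lborel. x s \<omega>)"
  unfolding progressive_def
proof
  fix t assume t: "t \<in> {0..T}"
  interpret L: sigma_finite_measure "leb t" by (rule sigma_finite_leb)
  have [measurable]: "case_prod x \<in> borel_measurable (leb t \<Otimes>\<^sub>M nat_filt M W t)"
    using t x by (simp add: progressiveD)
  have "(\<lambda>(s, \<omega>). \<integral>r. indicator {0..s} r *\<^sub>R x r \<omega> \<partial>leb t) \<in> borel_measurable (leb t \<Otimes>\<^sub>M nat_filt M W t)"
    unfolding indicator_def atLeastAtMost_iff using measurable_leb_ident[measurable] by measurable
  also have "?this \<longleftrightarrow> (\<lambda>(s, \<omega>). LINT r:{0..s}|lborel. x r \<omega>) \<in> borel_measurable (leb t \<Otimes>\<^sub>M nat_filt M W t)"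
  proof (intro measurable_cong)
    fix z assume "z \<in> space (leb t \<Otimes>\<^sub>M nat_filt M W t)"
    then have "fst z \<le> t"
      by (auto simp: space_pair_measure)
    then have "indicator {0..t} r *\<^sub>R (indicator {0..fst z} r *\<^sub>R x r (snd z)) = indicator {0..fst z} r *\<^sub>R x r (snd z)" for r
      by (auto simp: indicator_def)
    then show "(case z of (s, \<omega>) \<Rightarrow> \<integral>r. indicator {0..s} r *\<^sub>R x r \<omega> \<partial>leb t) = (case z of (s, \<omega>) \<Rightarrow> LINT r:{0..s}|lborel. x r \<omega>)"
      by (simp add: case_prod_unfold set_lebesgue_integral_def integral_restrict_space del: scaleR_scaleR)
  qed
  finally show "(\<lambda>(s, \<omega>). LINT r:{0..s}|lborel. x r \<omega>) \<in> borel_measurable (leb t \<Otimes>\<^sub>M nat_filt M W t)" .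
qed

text \<open>Cauchy-Schwarz against the constant 1, whose integral over [0,T] is the factor T. In
  \<open>ennreal\<close> the bound holds on every path, including those where \<open>h\<close> is
  not integrable on [0,t], since the integral then takes the default value 0.\<close>

lemma LINT_square_bound:
  fixes h :: "real \<Rightarrow> 'b::euclidean_space"
  assumes [measurable]: "h \<in> borel_measurable (leb T)" and t: "t \<in> {0..T}"
  shows "ennreal ((norm (LINT s:{0..t}|lborel. h s))\<^sup>2) \<le> ennreal T * (\<integral>\<^sup>+s. ennreal ((norm (h s))\<^sup>2) \<partial>leb T)"
proof -
  have "ennreal (norm (LINT s:{0..t}|lborel. h s)) \<le> (\<integral>\<^sup>+s. norm (h s) \<partial>leb t)"
    by (cases "integrable (leb t) h") (auto simp: LINT_leb integral_norm_bound_ennreal not_integrable_integral_eq)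
  also have "\<dots> \<le> (\<integral>\<^sup>+s. ennreal (norm (h s)) * 1 \<partial>leb T)"
    using t by (auto simp: nn_integral_restrict_space indicator_def intro!: nn_integral_mono)
  finally have "(ennreal (norm (LINT s:{0..t}|lborel. h s)))\<^sup>2 \<le> (\<integral>\<^sup>+s. ennreal (norm (h s)) * 1 \<partial>leb T)\<^sup>2"
    by (rule power_mono) simp
  also have "\<dots> \<le> (\<integral>\<^sup>+s. (ennreal (norm (h s)))\<^sup>2 \<partial>leb T) * (\<integral>\<^sup>+s. 1\<^sup>2 \<partial>leb T)"
    by (rule Cauchy_Schwarz_nn_integral) auto
  also have "(\<integral>\<^sup>+s. 1\<^sup>2 \<partial>leb T) = ennreal T"
    using T_pos by (simp add: emeasure_restrict_space emeasure_lborel_Icc_eq)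
  finally show ?thesis
    by (simp add: ennreal_power mult.commute)
qed

text \<open>The pathwise bound does not depend on t, so integrating it over time contributes a
  second factor T; Tonelli then exchanges the order on the right.\<close>

lemma L2F_LINT:
  assumes x: "L2F M W T x"
  shows "L2F M W T (\<lambda>t \<omega>. LINT s:{0..t}|lborel. x s \<omega>)"
proof -
  interpret P: pair_sigma_finite "leb T" M by (rule pair_sigma_finite_leb)
  define y where "y t \<omega> = (LINT s:{0..t}|lborel. x s \<omega>)" for t \<omega>
  have px: "progressive x"
    using x by (simp add: L2F_iff)
  have py: "progressive y"
    unfolding y_def by (rule progressive_LINT[OF px])
  note [measurable] = progressive_measurable[OF px] progressive_measurable[OF py]
  have "(\<integral>\<^sup>+z. (case z of (t, \<omega>) \<Rightarrow> ennreal ((norm (y t \<omega>))\<^sup>2)) \<partial>(leb T \<Otimes>\<^sub>M M))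
      = (\<integral>\<^sup>+t. \<integral>\<^sup>+\<omega>. ennreal ((norm (y t \<omega>))\<^sup>2) \<partial>M \<partial>leb T)"
    by (subst nn_integral_fst[symmetric]) auto
  also have "\<dots> \<le> (\<integral>\<^sup>+t. \<integral>\<^sup>+\<omega>. ennreal T * (\<integral>\<^sup>+s. ennreal ((norm (x s \<omega>))\<^sup>2) \<partial>leb T) \<partial>M \<partial>leb T)"
    unfolding y_def
    by (intro nn_integral_mono LINT_square_bound progressive_path[OF px]) auto
  also have "\<dots> = ennreal T * (ennreal T * (\<integral>\<^sup>+\<omega>. \<integral>\<^sup>+s. ennreal ((norm (x s \<omega>))\<^sup>2) \<partial>leb T \<partial>M))"
    using T_pos by (subst nn_integral_cmult) (auto simp: emeasure_restrict_space emeasure_lborel_Icc_eq mult.commute)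
  also have "(\<integral>\<^sup>+\<omega>. \<integral>\<^sup>+s. ennreal ((norm (x s \<omega>))\<^sup>2) \<partial>leb T \<partial>M) =
      (\<integral>\<^sup>+z. (case z of (t, \<omega>) \<Rightarrow> ennreal ((norm (x t \<omega>))\<^sup>2)) \<partial>(leb T \<Otimes>\<^sub>M M))"
    by (subst P.nn_integral_snd[symmetric]) auto
  also have "ennreal T * (ennreal T * \<dots>) < \<infinity>"
    using x unfolding L2F_iff integrable_iff_bounded
    by (auto simp: ennreal_mult_less_top case_prod_unfold less_top)
  finally have "integrable (leb T \<Otimes>\<^sub>M M) (\<lambda>(s, \<omega>). (norm (y s \<omega>))\<^sup>2)"
    unfolding integrable_iff_bounded by (auto simp: case_prod_unfold)
  with py show ?thesis
    unfolding L2F_iff y_def by simp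
qed

text \<open>A progressively measurable modification of \<open>W\<close>: the paths of \<open>W\<close> are continuous only
  almost surely and the natural filtration is not completed, so \<open>W\<close> itself need not be progressive.\<close>
definition Wprog :: "real \<Rightarrow> 'a \<Rightarrow> real^'d" where
  "Wprog t \<omega> = lim (\<lambda>n. W (real (nat \<lfloor>t * real (Suc n)\<rfloor>) / real (Suc n)) \<omega>)"

text \<open>The grid points lie below t at distance at most \<open>1 / Suc n\<close>, so continuity
  of the path identifies the limit. Sampling from the left is what keeps \<open>Wprog t\<close> free
  of later values of \<open>W\<close>.\<close>

lemma Wprog_AE: "AE \<omega> in M. \<forall>t\<ge>0. Wprog t \<omega> = W t \<omega>"
  using W_AE
proof eventually_elim
  fix \<omega> assume W: "W 0 \<omega> = 0 \<and> continuous_on {0..} (\<lambda>t. W t \<omega>)"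
  show "\<forall>t\<ge>0. Wprog t \<omega> = W t \<omega>"
  proof (intro allI impI)
    fix t :: real assume t: "0 \<le> t"
    have "(\<lambda>n. real (nat \<lfloor>t * real (Suc n)\<rfloor>) / real (Suc n)) \<longlonglongrightarrow> t"
    proof (rule tendsto_sandwich)
      show "\<forall>\<^sub>F n in sequentially. t - 1 / real (Suc n) \<le> real (nat \<lfloor>t * real (Suc n)\<rfloor>) / real (Suc n)"
      proof (rule always_eventually, rule allI)
        fix n
        have "t * real (Suc n) - 1 \<le> real (nat \<lfloor>t * real (Suc n)\<rfloor>)"
          using t by linarith
        then have "(t * real (Suc n) - 1) / real (Suc n) \<le> real (nat \<lfloor>t * real (Suc n)\<rfloor>) / real (Suc n)"
          by (intro divide_right_mono) auto
        then show "t - 1 / real (Suc n) \<le> real (nat \<lfloor>t * real (Suc n)\<rfloor>) / real (Suc n)"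
          by (simp add: diff_divide_distrib)
      qed
      show "\<forall>\<^sub>F n in sequentially. real (nat \<lfloor>t * real (Suc n)\<rfloor>) / real (Suc n) \<le> t"
        using t by (intro always_eventually allI) (auto simp: divide_le_eq)
      show "(\<lambda>n. t - 1 / real (Suc n)) \<longlonglongrightarrow> t"
        using tendsto_diff[OF tendsto_const LIMSEQ_Suc[OF lim_1_over_n]] by simp
    qed simp
    then have "(\<lambda>n. W (real (nat \<lfloor>t * real (Suc n)\<rfloor>) / real (Suc n)) \<omega>) \<longlonglongrightarrow> W t \<omega>"
      using W t by (intro continuous_on_tendsto_compose[of "{0..}" "\<lambda>t. W t \<omega>"]) auto
    then show "Wprog t \<omega> = W t \<omega>"
      unfolding Wprog_def by (rule limI)
  qed
qed

text \<open>Each approximation takes its value from countably many random variables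
  \<open>W (i / Suc n)\<close>, selected by a measurable index. \<open>lim\<close> preserves
  measurability even at points without convergence, so no null sets have to be added to the
  filtration.\<close>

lemma progressive_Wprog: "progressive Wprog"
  unfolding progressive_def
proof
  fix t assume t: "t \<in> {0..T}"
  have W': "(\<lambda>z. W (real (nat \<lfloor>fst z * real (Suc n)\<rfloor>) / real (Suc n)) (snd z))
      \<in> borel_measurable (leb t \<Otimes>\<^sub>M nat_filt M W t)" for n
  proof -
    \<comment> \<open>Every index \<open>i\<close> must give a function measurable at time t,
      including grid times beyond t. The default 0 used there is never selected, because the grid
      time chosen for s is at most s <= t.\<close>
    define f where "f i z = (if real i / real (Suc n) \<le> t then W (real i / real (Suc n)) (snd z) else 0)"
      for i :: nat and z :: "real \<times> 'a"
    have f: "f i \<in> borel_measurable (leb t \<Otimes>\<^sub>M nat_filt M W t)" for i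
    proof (cases "real i / real (Suc n) \<le> t")
      case True
      have "W (real i / real (Suc n)) \<in> borel_measurable (nat_filt M W t)"
        by (rule W_nat_filt_measurable[OF _ True]) simp
      from measurable_compose[OF measurable_snd this] show ?thesis
        unfolding f_def if_P[OF True] .
    next
      case False
      show ?thesis
        unfolding f_def if_not_P[OF False] by simp
    qed
    have "(\<lambda>z. f (nat \<lfloor>fst z * real (Suc n)\<rfloor>) z) \<in> borel_measurable (leb t \<Otimes>\<^sub>M nat_filt M W t)"
      using measurable_leb_ident[measurable] by (intro measurable_compose_countable[OF f]) measurable
    also have "?this \<longleftrightarrow> ?thesis"
    proof (rule measurable_cong)
      fix z assume "z \<in> space (leb t \<Otimes>\<^sub>M nat_filt M W t)"
      then have z: "0 \<le> fst z" "fst z \<le> t" by (auto simp: space_pair_measure)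
      have "real (nat \<lfloor>fst z * real (Suc n)\<rfloor>) \<le> fst z * real (Suc n)"
        using z by auto
      also have "\<dots> \<le> t * real (Suc n)"
        using z by (intro mult_right_mono) auto
      finally show "f (nat \<lfloor>fst z * real (Suc n)\<rfloor>) z = W (real (nat \<lfloor>fst z * real (Suc n)\<rfloor>) / real (Suc n)) (snd z)"
        by (simp add: f_def divide_le_eq)
    qed
    finally show ?thesis .
  qed
  show "(\<lambda>(s, \<omega>). Wprog s \<omega>) \<in> borel_measurable (leb t \<Otimes>\<^sub>M nat_filt M W t)"
    unfolding Wprog_def case_prod_unfold by (rule borel_measurable_lim_metric[OF W'])
qed

text \<open>The coordinates of \<open>W t - W 0\<close> are centred normal with variance t, and
  \<open>W 0 = 0\<close> holds only almost surely, so moments are transferred along almost sure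
  equality. The normal law is given for s < t only, which is why t = 0 is treated apart.\<close>

lemma W_square:
  assumes t: "0 \<le> t"
  shows "integrable M (\<lambda>\<omega>. (norm (W t \<omega>))\<^sup>2)" "(\<integral>\<omega>. (norm (W t \<omega>))\<^sup>2 \<partial>M) = real CARD('d) * t"
proof -
  note [measurable] = W_measurable[OF t]
  have nth: "(\<lambda>v::real^'d. v $ j) \<in> borel_measurable borel" for j
    by (intro borel_measurable_continuous_onI continuous_intros)
  have [measurable]: "(\<lambda>\<omega>. W t \<omega> $ j) \<in> borel_measurable M" for j
    by (rule measurable_compose[OF _ nth]) measurable
  have *: "integrable M (\<lambda>\<omega>. (W t \<omega> $ j)\<^sup>2) \<and> (\<integral>\<omega>. (W t \<omega> $ j)\<^sup>2 \<partial>M) = t" for j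
  proof (cases "t = 0")
    case True
    have "AE \<omega> in M. (W t \<omega> $ j)\<^sup>2 = 0"
      using W_AE by eventually_elim (simp add: True)
    moreover have "(\<lambda>\<omega>. (W t \<omega> $ j)\<^sup>2) \<in> borel_measurable M"
      by measurable
    ultimately have "has_bochner_integral M (\<lambda>\<omega>. (W t \<omega> $ j)\<^sup>2) 0"
      by (subst has_bochner_integral_cong_AE[where g = "\<lambda>_. 0"]) auto
    then show ?thesis
      unfolding has_bochner_integral_iff True .
  next
    case False
    with t have t': "0 < sqrt t" "0 < t" by auto
    have D: "distributed M lborel (\<lambda>\<omega>. (W t \<omega> - W 0 \<omega>) $ j) (\<lambda>x. ennreal (normal_density 0 (sqrt t) x))"
    proof -
      have "\<forall>s t. 0 \<le> s \<and> s < t \<longrightarrow> (\<forall>j. distributed M lborel (\<lambda>\<omega>. (W t \<omega> - W s \<omega>) $ j)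
               (\<lambda>x. ennreal (normal_density 0 (sqrt (t - s)) x)))"
        using BM unfolding std_BM_def by blast
      from this[rule_format, of 0 t j] show ?thesis
        using t' by simp
    qed
    define X where "X \<omega> = (W t \<omega> - W 0 \<omega>) $ j" for \<omega>
    have [measurable]: "W 0 \<in> borel_measurable M" by (simp add: W_measurable)
    have [measurable]: "X \<in> borel_measurable M"
      unfolding X_def by (rule measurable_compose[OF _ nth]) measurable
    have D: "distributed M lborel X (\<lambda>x. ennreal (normal_density 0 (sqrt t) x))"
      using D by (simp add: X_def[abs_def])
    have "integrable lborel (\<lambda>x. normal_density 0 (sqrt t) x * x\<^sup>2)"
      using integrable_normal_moment[OF t'(1), of 0 2] by simp
    then have i: "integrable M (\<lambda>\<omega>. (X \<omega>)\<^sup>2)"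
      by (subst (asm) distributed_integrable[OF D]) simp_all
    have "expectation X = 0"
      by (rule normal_distributed_expectation[OF t'(1) D])
    then have v: "(\<integral>\<omega>. (X \<omega>)\<^sup>2 \<partial>M) = t"
      using normal_distributed_variance[OF t'(1) D] t' by simp
    have e: "AE \<omega> in M. (X \<omega>)\<^sup>2 = (W t \<omega> $ j)\<^sup>2"
      using W_AE by eventually_elim (simp add: X_def)
    have m: "(\<lambda>\<omega>. (X \<omega>)\<^sup>2) \<in> borel_measurable M" "(\<lambda>\<omega>. (W t \<omega> $ j)\<^sup>2) \<in> borel_measurable M"
      by measurable
    show ?thesis
      using i v unfolding integrable_cong_AE[OF m e] integral_cong_AE[OF m e] ..
  qed
  have norm: "(norm v)\<^sup>2 = (\<Sum>j\<in>UNIV. (v $ j)\<^sup>2)" for v :: "real^'d"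
    unfolding power2_norm_eq_inner inner_vec_def by (simp add: power2_eq_square)
  show "integrable M (\<lambda>\<omega>. (norm (W t \<omega>))\<^sup>2)"
    unfolding norm using * by (intro Bochner_Integration.integrable_sum) blast
  have "(\<integral>\<omega>. (norm (W t \<omega>))\<^sup>2 \<partial>M) = (\<Sum>j\<in>UNIV. \<integral>\<omega>. (W t \<omega> $ j)\<^sup>2 \<partial>M)"
    unfolding norm using * by (intro Bochner_Integration.integral_sum) blast
  also have "\<dots> = (\<Sum>j\<in>(UNIV::'d set). t)"
    using * by (intro sum.cong) blast+
  finally show "(\<integral>\<omega>. (norm (W t \<omega>))\<^sup>2 \<partial>M) = real CARD('d) * t"
    by simp
qed

text \<open>The second moment at a fixed time is that of \<open>W\<close>, which agrees with
  \<open>Wprog\<close> there almost surely; the joint measurability needed for Tonelli comes from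
  \<open>Wprog\<close>.\<close>

lemma L2F_Wprog: "L2F M W T Wprog"
proof -
  interpret P: pair_sigma_finite "leb T" M by (rule pair_sigma_finite_leb)
  note [measurable] = progressive_measurable[OF progressive_Wprog]
  have "(\<integral>\<^sup>+z. (case z of (t, \<omega>) \<Rightarrow> ennreal ((norm (Wprog t \<omega>))\<^sup>2)) \<partial>(leb T \<Otimes>\<^sub>M M))
      = (\<integral>\<^sup>+t. \<integral>\<^sup>+\<omega>. ennreal ((norm (Wprog t \<omega>))\<^sup>2) \<partial>M \<partial>leb T)"
    by (subst nn_integral_fst[symmetric]) auto
  also have "\<dots> \<le> (\<integral>\<^sup>+t. ennreal (real CARD('d) * T) \<partial>leb T)"
  proof (rule nn_integral_mono)
    fix t assume "t \<in> space (leb T)"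
    then have t: "0 \<le> t" "t \<le> T" by auto
    have "(\<integral>\<^sup>+\<omega>. ennreal ((norm (Wprog t \<omega>))\<^sup>2) \<partial>M) = (\<integral>\<^sup>+\<omega>. ennreal ((norm (W t \<omega>))\<^sup>2) \<partial>M)"
    proof (rule nn_integral_cong_AE)
      show "AE \<omega> in M. ennreal ((norm (Wprog t \<omega>))\<^sup>2) = ennreal ((norm (W t \<omega>))\<^sup>2)"
        using Wprog_AE by eventually_elim (simp add: t)
    qed
    also have "\<dots> = ennreal (real CARD('d) * t)"
      using W_square[OF t(1)] by (subst nn_integral_eq_integral) auto
    also have "\<dots> \<le> ennreal (real CARD('d) * T)"
      using t by (intro ennreal_leI mult_left_mono) auto
    finally show "(\<integral>\<^sup>+\<omega>. ennreal ((norm (Wprog t \<omega>))\<^sup>2) \<partial>M) \<le> ennreal (real CARD('d) * T)" .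
  qed
  also have "\<dots> < \<infinity>"
    by (simp add: emeasure_restrict_space emeasure_lborel_Icc_eq ennreal_mult_less_top)
  finally have "integrable (leb T \<Otimes>\<^sub>M M) (\<lambda>(s, \<omega>). (norm (Wprog s \<omega>))\<^sup>2)"
    unfolding integrable_iff_bounded by (auto simp: case_prod_unfold)
  then show ?thesis
    by (simp add: L2F_iff progressive_Wprog)
qed

end

subsection \<open>Solutions in integral form\<close>

lemma linear_vec: "linear ((*v) A)" for A :: "real^'m^'n"
  by (rule matrix_vector_mul_linear)

lemma transpose_inner: "(transpose A *v x) \<bullet> y = x \<bullet> (A *v y)" for A :: "real^'m^'n"
  by (simp add: dot_lmul_matrix)

lemma LINT_linear:
  fixes h :: "'b::euclidean_space \<Rightarrow> 'c::euclidean_space" and f :: "real \<Rightarrow> 'b"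
  assumes "linear h" "set_integrable lborel A f"
  shows "(LINT s:A|lborel. h (f s)) = h (LINT s:A|lborel. f s)" "set_integrable lborel A (\<lambda>s. h (f s))"
proof -
  have bl: "bounded_linear h"
    using assms(1) by (simp add: linear_conv_bounded_linear)
  note eq = linear_scale[OF assms(1), symmetric]
  show "(LINT s:A|lborel. h (f s)) = h (LINT s:A|lborel. f s)"
    using integral_bounded_linear[OF bl assms(2)[unfolded set_integrable_def]]
    unfolding set_lebesgue_integral_def eq .
  show "set_integrable lborel A (\<lambda>s. h (f s))"
    using integrable_bounded_linear[OF bl assms(2)[unfolded set_integrable_def]]
    unfolding set_integrable_def eq .
qed

lemma ode_solD:
  assumes "ode_sol T r y"
  shows "set_integrable lborel {0..T} r"
    and "t \<in> {0..T} \<Longrightarrow> y t = y 0 + (LINT s:{0..t}|lborel. r s)"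
  using assms unfolding ode_sol_def by blast+

lemma ode_solI:
  assumes "set_integrable lborel {0..T} r"
    and "\<And>t. t \<in> {0..T} \<Longrightarrow> y t = y 0 + (LINT s:{0..t}|lborel. r s)"
  shows "ode_sol T r y"
  using assms unfolding ode_sol_def by blast

text \<open>The inhomogeneity \<open>h\<close> is only integrable. Its indefinite integral is moved
  into the forcing, which is thereby continuous, as \<open>volterra\<close> requires.\<close>

lemma volterra_ode:
  fixes L :: "'b::euclidean_space \<Rightarrow> 'b"
  assumes L: "linear L" and h: "integrable (leb T) h" and T: "0 \<le> T"
  obtains y where "continuous_on {0..T} y" "y 0 = y0" "ode_sol T (\<lambda>s. L (y s) + h s) y"
proof
  define k where "k t = y0 + (LINT s:{0..t}|lborel. h s)" for t
  define y where "y = volterra L k"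
  have h': "set_integrable lborel {0..T} h"
    using h by (simp add: set_integrable_leb)
  have k: "continuous_on {0..T} k"
    unfolding k_def by (intro continuous_intros continuous_on_LINT h')
  show y: "continuous_on {0..T} y"
    unfolding y_def by (rule volterra_continuous[OF L k])
  have Ly: "set_integrable lborel {0..T} (\<lambda>s. L (y s))"
    unfolding set_integrable_leb
    by (intro integrable_leb_continuous linear_continuous_on_compose[OF y L])
  have yt: "y t = y0 + (LINT s:{0..t}|lborel. L (y s) + h s)" if t: "t \<in> {0..T}" for t
  proof -
    have sub: "set_integrable lborel {0..t} (\<lambda>s. L (y s))" "set_integrable lborel {0..t} h"
      by (rule set_integrable_subset[OF Ly] set_integrable_subset[OF h']; use t in auto)+
    show ?thesis
      using volterra_solves[OF L k t] unfolding y_def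
      by (subst set_integral_add(2)[OF sub[unfolded y_def]]) (simp add: k_def)
  qed
  show y0: "y 0 = y0"
    using yt[of 0] T by (simp add: LINT_singleton)
  show "ode_sol T (\<lambda>s. L (y s) + h s) y"
    by (intro ode_solI set_integral_add(1) Ly h', unfold y0, rule yt)
qed

lemma ode_sol_integrable: "ode_sol T r y \<Longrightarrow> integrable (leb T) r"
  using ode_solD(1) by (simp add: set_integrable_leb)

lemma ode_sol_continuous: "ode_sol T r y \<Longrightarrow> continuous_on {0..T} y"
  by (subst continuous_on_cong[OF refl ode_solD(2)])
    (auto intro!: continuous_intros continuous_on_LINT intro: ode_solD(1))

lemma LINT_cong_leb:
  fixes f g :: "real \<Rightarrow> 'b::euclidean_space"
  assumes "\<And>s. s \<in> {0..T} \<Longrightarrow> f s = g s" "t \<in> {0..T}"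
  shows "(LINT s:{0..t}|lborel. f s) = (LINT s:{0..t}|lborel. g s)"
  using assms by (intro set_lebesgue_integral_cong) auto

lemma ode_sol_cong:
  fixes r r' :: "real \<Rightarrow> 'b::euclidean_space"
  assumes "\<And>s. s \<in> {0..T} \<Longrightarrow> r s = r' s" "ode_sol T r y"
  shows "ode_sol T r' y"
proof (rule ode_solI)
  show "set_integrable lborel {0..T} r'"
    using ode_solD(1)[OF assms(2)] assms(1) by (subst set_integrable_cong[OF refl refl, of _ _ r]) auto
  show "y t = y 0 + (LINT s:{0..t}|lborel. r' s)" if t: "t \<in> {0..T}" for t
    using ode_solD(2)[OF assms(2) t] LINT_cong_leb[of T r r', OF assms(1) t] by simp
qed

lemma ode_sol_unique:
  fixes L :: "'b::euclidean_space \<Rightarrow> 'b"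
  assumes "linear L" and y: "ode_sol T (\<lambda>s. L (y s) + h s) y" and y': "ode_sol T (\<lambda>s. L (y' s) + h s) y'"
    and y0: "y' 0 = y 0" and t: "t \<in> {0..T}"
  shows "y' t = y t"
  by (rule volterra_unique[where c = "\<lambda>_. y 0", OF assms(1) ode_solD(1)[OF y] ode_solD(1)[OF y']
        ode_solD(2)[OF y] ode_solD(2)[OF y', unfolded y0] t])

lemma ode_sol_add:
  assumes y: "ode_sol T r y" and y': "ode_sol T r' y'"
  shows "ode_sol T (\<lambda>s. r s + r' s) (\<lambda>t. y t + y' t)"
proof (rule ode_solI)
  show "set_integrable lborel {0..T} (\<lambda>s. r s + r' s)"
    by (intro set_integral_add(1) ode_solD(1)[OF y] ode_solD(1)[OF y'])
  show "y t + y' t = y 0 + y' 0 + (LINT s:{0..t}|lborel. r s + r' s)" if t: "t \<in> {0..T}" for t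
  proof -
    have "set_integrable lborel {0..t} r" "set_integrable lborel {0..t} r'"
      by (rule set_integrable_subset[OF ode_solD(1)[OF y]] set_integrable_subset[OF ode_solD(1)[OF y']];
          use t in auto)+
    from set_integral_add(2)[OF this] show ?thesis
      by (subst ode_solD(2)[OF y t], subst ode_solD(2)[OF y' t]) simp
  qed
qed

lemma ode_sol_linear:
  fixes h :: "'b::euclidean_space \<Rightarrow> 'c::euclidean_space"
  assumes h: "linear h" and y: "ode_sol T r y"
  shows "ode_sol T (\<lambda>s. h (r s)) (\<lambda>t. h (y t))"
proof -
  note r = ode_solD(1)[OF y] and eq = ode_solD(2)[OF y]
  have "h (y t) = h (y 0) + (LINT s:{0..t}|lborel. h (r s))" if t: "t \<in> {0..T}" for t
  proof -
    have "set_integrable lborel {0..t} r"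
      using t by (intro set_integrable_subset[OF r]) auto
    then show ?thesis
      by (subst eq[OF t]) (simp add: LINT_linear(1)[OF h] linear_add[OF h])
  qed
  then show ?thesis
    by (intro ode_solI LINT_linear(2)[OF h r])
qed

lemma propagator_ode_sol:
  fixes L :: "'b::euclidean_space \<Rightarrow> 'b"
  assumes L: "linear L"
  shows "ode_sol T (\<lambda>s. L (propagator L s v)) (\<lambda>t. propagator L t v)"
proof (rule ode_solI)
  have c: "continuous_on S (\<lambda>t. L (propagator L t v))" for S
    by (intro linear_continuous_on_compose[OF _ L] propagator_continuous[OF L] continuous_intros)
  show "set_integrable lborel {0..T} (\<lambda>s. L (propagator L s v))"
    unfolding set_integrable_leb by (rule integrable_leb_continuous[OF c])
  show "propagator L t v = propagator L 0 v + (LINT s:{0..t}|lborel. L (propagator L s v))"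
    if "t \<in> {0..T}" for t
  proof -
    have "((\<lambda>t. propagator L t v) has_vector_derivative L (propagator L t v)) (at t within {0..T})" for t
      by (rule has_vector_derivative_at_within[OF propagator_has_vector_derivative[OF L]])
    from LINT_eq_diff[OF this c that] show ?thesis by simp
  qed
qed

lemma propagator_bounded:
  fixes L :: "'b::euclidean_space \<Rightarrow> 'b"
  assumes L: "linear L"
  obtains C where "\<And>t v. t \<in> {a..b} \<Longrightarrow> norm (propagator L t v) \<le> C * norm v"
proof -
  have "\<exists>c. \<forall>t\<in>{a..b}. norm (propagator L t e) \<le> c" for e
  proof -
    have "compact ((\<lambda>t. propagator L t e) ` {a..b})"
      by (intro compact_continuous_image propagator_continuous[OF L] continuous_intros) auto
    from compact_imp_bounded[OF this] show ?thesis
      unfolding bounded_iff by auto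
  qed
  then have "\<exists>c. \<forall>e. \<forall>t\<in>{a..b}. norm (propagator L t e) \<le> c e"
    by (intro choice allI)
  then obtain c where c: "\<And>e t. t \<in> {a..b} \<Longrightarrow> norm (propagator L t e) \<le> c e"
    by blast
  have "norm (propagator L t v) \<le> (\<Sum>e\<in>Basis. c e) * norm v" if t: "t \<in> {a..b}" for t v
  proof -
    have "norm (propagator L t v) \<le> (\<Sum>e\<in>Basis. norm ((v \<bullet> e) *\<^sub>R propagator L t e))"
      by (subst propagator_expand[OF L]) (rule norm_sum)
    also have "\<dots> \<le> (\<Sum>e\<in>Basis. norm v * c e)"
      using c[OF t] by (intro sum_mono) (auto intro!: mult_mono Basis_le_norm)
    finally show ?thesis
      by (simp add: sum_distrib_left mult.commute)
  qed
  then show thesis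
    by (rule that)
qed

section \<open>Integration by parts for absolutely continuous functions\<close>

lemma integrable_inner_continuous:
  fixes a z :: "real \<Rightarrow> 'b::euclidean_space"
  assumes a: "integrable (leb T) a" and z: "continuous_on {0..T} z"
  shows "integrable (leb T) (\<lambda>t. a t \<bullet> z t)"
proof -
  have "compact (z ` {0..T})"
    by (intro compact_continuous_image z) auto
  from compact_imp_bounded[OF this]
  obtain C where C: "\<And>t. t \<in> {0..T} \<Longrightarrow> norm (z t) \<le> C"
    unfolding bounded_iff by blast
  have [measurable]: "z \<in> borel_measurable (leb T)"
    using integrable_leb_continuous[OF z] by simp
  note [measurable] = borel_measurable_integrable[OF a]
  show ?thesis
  proof (rule Bochner_Integration.integrable_bound)
    show "integrable (leb T) (\<lambda>t. norm (a t) * C)"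
      using a by (intro integrable_mult_left integrable_norm)
    show "AE t in leb T. norm (a t \<bullet> z t) \<le> norm (norm (a t) * C)"
    proof (rule AE_I2)
      fix t assume "t \<in> space (leb T)"
      then have "norm (a t) * norm (z t) \<le> norm (a t) * C"
        by (intro mult_left_mono C) auto
      then show "norm (a t \<bullet> z t) \<le> norm (norm (a t) * C)"
        using Cauchy_Schwarz_ineq2[of "a t" "z t"] unfolding real_norm_def by linarith
    qed
  qed measurable
qed

text \<open>The product of the integrals is the integral of a(s) . b(t) over the square [0,T] x
  [0,T]; the diagonal cuts the square into two triangles, one for each summand. Fubini takes the
  place of the product rule, since primitives of merely integrable functions need not be
  differentiable at every point.\<close>

lemma integral_by_parts_zero:
  fixes a b :: "real \<Rightarrow> 'b::euclidean_space"
  assumes a: "integrable (leb T) a" and b: "integrable (leb T) b"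
  shows "integral\<^sup>L (leb T) a \<bullet> integral\<^sup>L (leb T) b =
     (\<integral>t. a t \<bullet> (LINT s:{0..t}|lborel. b s) \<partial>leb T) + (\<integral>t. (LINT s:{0..t}|lborel. a s) \<bullet> b t \<partial>leb T)"
proof -
  interpret S: sigma_finite_measure "leb T" by (rule sigma_finite_leb)
  interpret P: pair_sigma_finite "leb T" "leb T" ..
  note [measurable] = borel_measurable_integrable[OF a] borel_measurable_integrable[OF b]
  have K: "integrable (leb T \<Otimes>\<^sub>M leb T) (\<lambda>(s, t). a s \<bullet> b t)"
  proof (rule P.Fubini_integrable)
    show "integrable (leb T) (\<lambda>s. \<integral>t. norm (case (s, t) of (s, t) \<Rightarrow> a s \<bullet> b t) \<partial>leb T)"
    proof (rule Bochner_Integration.integrable_bound)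
      show "integrable (leb T) (\<lambda>s. norm (a s) * (\<integral>t. norm (b t) \<partial>leb T))"
        using a by (intro integrable_mult_left integrable_norm)
      show "AE s in leb T. norm (\<integral>t. norm (case (s, t) of (s, t) \<Rightarrow> a s \<bullet> b t) \<partial>leb T)
          \<le> norm (norm (a s) * (\<integral>t. norm (b t) \<partial>leb T))"
      proof (rule AE_I2)
        fix s
        have "(\<integral>t. norm (a s \<bullet> b t) \<partial>leb T) \<le> (\<integral>t. norm (a s) * norm (b t) \<partial>leb T)"
          using b by (intro integral_mono integrable_norm integrable_mult_right integrable_inner_right)
            (simp_all add: Cauchy_Schwarz_ineq2)
        then show "norm (\<integral>t. norm (case (s, t) of (s, t) \<Rightarrow> a s \<bullet> b t) \<partial>leb T)
          \<le> norm (norm (a s) * (\<integral>t. norm (b t) \<partial>leb T))"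
          by simp
      qed
    qed measurable
    show "AE s in leb T. integrable (leb T) (\<lambda>t. case (s, t) of (s, t) \<Rightarrow> a s \<bullet> b t)"
      using b by (auto intro!: integrable_inner_right)
  qed measurable
  have LINT: "(LINT s:{0..t}|lborel. c s) = (\<integral>s. indicator {0..t} s *\<^sub>R c s \<partial>leb T)" if "t \<in> {0..T}"
    for c :: "real \<Rightarrow> 'b" and t
    using that by (auto simp: set_lebesgue_integral_def integral_restrict_space indicator_def intro!: Bochner_Integration.integral_cong)
  have ind: "integrable (leb T) (\<lambda>s. indicator {0..t} s *\<^sub>R c s)" if "integrable (leb T) c" "t \<in> {0..T}" for c :: "real \<Rightarrow> 'b" and t
    using that by (intro integrable_mult_indicator) (auto simp: sets_restrict_space intro!: image_eqI[of _ _ "{0..t}"])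
  have 1: "(\<integral>t. a t \<bullet> (LINT s:{0..t}|lborel. b s) \<partial>leb T) = (\<integral>t. (\<integral>s. indicator {0..t} s * (a t \<bullet> b s) \<partial>leb T) \<partial>leb T)"
  proof (rule Bochner_Integration.integral_cong[OF refl])
    fix t assume "t \<in> space (leb T)"
    then have t: "t \<in> {0..T}" by simp
    show "a t \<bullet> (LINT s:{0..t}|lborel. b s) = (\<integral>s. indicator {0..t} s * (a t \<bullet> b s) \<partial>leb T)"
      unfolding LINT[OF t] integral_inner_right[OF ind[OF b t], symmetric] inner_scaleR_right ..
  qed
  have K2: "integrable (leb T \<Otimes>\<^sub>M leb T) (\<lambda>(s, t). indicator {0..t} s * (a s \<bullet> b t))"
  proof (rule Bochner_Integration.integrable_bound[OF K])
    show "(\<lambda>(s, t). indicator {0..t} s * (a s \<bullet> b t)) \<in> borel_measurable (leb T \<Otimes>\<^sub>M leb T)"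
      unfolding indicator_def atLeastAtMost_iff using measurable_leb_ident[measurable] by measurable
  qed (auto simp: indicator_def)
  have "(\<integral>t. (LINT s:{0..t}|lborel. a s) \<bullet> b t \<partial>leb T) = (\<integral>t. (\<integral>s. indicator {0..t} s * (a s \<bullet> b t) \<partial>leb T) \<partial>leb T)"
  proof (rule Bochner_Integration.integral_cong[OF refl])
    fix t assume "t \<in> space (leb T)"
    then have t: "t \<in> {0..T}" by simp
    show "(LINT s:{0..t}|lborel. a s) \<bullet> b t = (\<integral>s. indicator {0..t} s * (a s \<bullet> b t) \<partial>leb T)"
      unfolding LINT[OF t] integral_inner_left[OF ind[OF a t], symmetric] inner_scaleR_left ..
  qed
  \<comment> \<open>Only this summand has its order of integration swapped; afterwards both inner
    integrals run over t at fixed s and can be added.\<close>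
  also have "\<dots> = (\<integral>s. (\<integral>t. indicator {0..t} s * (a s \<bullet> b t) \<partial>leb T) \<partial>leb T)"
    by (rule P.Fubini_integral[OF K2])
  finally have 2: "(\<integral>t. (LINT s:{0..t}|lborel. a s) \<bullet> b t \<partial>leb T) = \<dots>" .
  have K1: "integrable (leb T \<Otimes>\<^sub>M leb T) (\<lambda>(s, t). indicator {0..s} t * (a s \<bullet> b t))"
  proof (rule Bochner_Integration.integrable_bound[OF K])
    show "(\<lambda>(s, t). indicator {0..s} t * (a s \<bullet> b t)) \<in> borel_measurable (leb T \<Otimes>\<^sub>M leb T)"
      unfolding indicator_def atLeastAtMost_iff using measurable_leb_ident[measurable] by measurable
  qed (auto simp: indicator_def)
  have "(\<integral>t. a t \<bullet> (LINT s:{0..t}|lborel. b s) \<partial>leb T) + (\<integral>t. (LINT s:{0..t}|lborel. a s) \<bullet> b t \<partial>leb T)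
     = (\<integral>s. (\<integral>t. indicator {0..s} t * (a s \<bullet> b t) \<partial>leb T) + (\<integral>t. indicator {0..t} s * (a s \<bullet> b t) \<partial>leb T) \<partial>leb T)"
    unfolding 1 2 using P.integrable_fst[OF K1] P.integrable_fst[OF K2]
    by (intro Bochner_Integration.integral_add[symmetric])
  also have "\<dots> = (\<integral>s. a s \<bullet> integral\<^sup>L (leb T) b \<partial>leb T)"
  proof (rule Bochner_Integration.integral_cong[OF refl])
    fix s assume "s \<in> space (leb T)"
    then have s: "0 \<le> s" "s \<le> T" by auto
    have i: "integrable (leb T) (\<lambda>t. a s \<bullet> b t)"
      using b by (rule integrable_inner_right)
    note [measurable] = measurable_leb_ident borel_measurable_integrable[OF i]
    have i1: "integrable (leb T) (\<lambda>t. indicator {0..s} t * (a s \<bullet> b t))"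
    proof (rule Bochner_Integration.integrable_bound[OF i])
      show "(\<lambda>t. indicator {0..s} t * (a s \<bullet> b t)) \<in> borel_measurable (leb T)"
        unfolding indicator_def atLeastAtMost_iff by measurable
    qed (auto simp: indicator_def)
    have i2: "integrable (leb T) (\<lambda>t. indicator {0..t} s * (a s \<bullet> b t))"
    proof (rule Bochner_Integration.integrable_bound[OF i])
      show "(\<lambda>t. indicator {0..t} s * (a s \<bullet> b t)) \<in> borel_measurable (leb T)"
        unfolding indicator_def atLeastAtMost_iff by measurable
    qed (auto simp: indicator_def)
    have "(\<integral>t. indicator {0..s} t * (a s \<bullet> b t) \<partial>leb T) + (\<integral>t. indicator {0..t} s * (a s \<bullet> b t) \<partial>leb T)
       = (\<integral>t. indicator {0..s} t * (a s \<bullet> b t) + indicator {0..t} s * (a s \<bullet> b t) \<partial>leb T)"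
      using i1 i2 by (rule Bochner_Integration.integral_add[symmetric])
    \<comment> \<open>For t different from s exactly one of the two indicators is 1. At t = s both
      are, but that is a single point.\<close>
    also have "\<dots> = (\<integral>t. a s \<bullet> b t \<partial>leb T)"
    proof (rule integral_cong_AE)
      have "AE t in lborel. t \<noteq> s"
        by (rule AE_lborel_singleton)
      then have "AE t in leb T. t \<noteq> s"
        by (auto simp: AE_restrict_space_iff)
      then show "AE t in leb T. indicator {0..s} t * (a s \<bullet> b t) + indicator {0..t} s * (a s \<bullet> b t) = a s \<bullet> b t"
        using AE_space by eventually_elim (use s in \<open>auto simp: indicator_def\<close>)
    qed (use i i1 i2 in \<open>simp_all add: borel_measurable_integrable\<close>)
    also have "\<dots> = a s \<bullet> integral\<^sup>L (leb T) b"
      using b by (simp add: integral_inner_right)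
    finally show "(\<integral>t. indicator {0..s} t * (a s \<bullet> b t) \<partial>leb T) + (\<integral>t. indicator {0..t} s * (a s \<bullet> b t) \<partial>leb T)
       = a s \<bullet> integral\<^sup>L (leb T) b" .
  qed
  also have "\<dots> = integral\<^sup>L (leb T) a \<bullet> integral\<^sup>L (leb T) b"
    using a by (simp add: integral_inner_left)
  finally show ?thesis ..
qed

text \<open>Apply the preceding identity to p - p(0) and z. The constant p(0) contributes p(0) .
  z(T), which restores p(T) on the left; the boundary term at 0 vanishes with z(0).\<close>

lemma ode_sol_by_parts:
  fixes p z :: "real \<Rightarrow> 'b::euclidean_space"
  assumes p: "ode_sol T a p" and z: "ode_sol T b z" and z0: "z 0 = 0" and T: "0 \<le> T"
  shows "p T \<bullet> z T = (\<integral>t. a t \<bullet> z t + p t \<bullet> b t \<partial>leb T)"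
proof -
  have a: "integrable (leb T) a" and b: "integrable (leb T) b"
    using p z by (auto intro: ode_sol_integrable)
  have pt: "p t = p 0 + (LINT s:{0..t}|lborel. a s)" and zt: "z t = (LINT s:{0..t}|lborel. b s)"
    if "t \<in> {0..T}" for t
    using ode_solD(2)[OF p that] ode_solD(2)[OF z that] z0 by simp_all
  have i1: "integrable (leb T) (\<lambda>t. a t \<bullet> z t)"
    by (rule integrable_inner_continuous[OF a ode_sol_continuous[OF z]])
  have i2: "integrable (leb T) (\<lambda>t. p t \<bullet> b t)"
    using integrable_inner_continuous[OF b ode_sol_continuous[OF p]] by (simp add: inner_commute)
  have i3: "integrable (leb T) (\<lambda>t. p 0 \<bullet> b t)"
    using b by (rule integrable_inner_right)
  have "(\<integral>t. (LINT s:{0..t}|lborel. a s) \<bullet> b t \<partial>leb T) = (\<integral>t. p t \<bullet> b t - p 0 \<bullet> b t \<partial>leb T)"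
  proof (intro Bochner_Integration.integral_cong refl)
    fix t assume "t \<in> space (leb T)"
    then have "(LINT s:{0..t}|lborel. a s) = p t - p 0"
      using pt[of t] by simp
    then show "(LINT s:{0..t}|lborel. a s) \<bullet> b t = p t \<bullet> b t - p 0 \<bullet> b t"
      by (simp add: inner_diff_left)
  qed
  also have "\<dots> = (\<integral>t. p t \<bullet> b t \<partial>leb T) - p 0 \<bullet> integral\<^sup>L (leb T) b"
    using i2 i3 b by simp
  finally have *: "(\<integral>t. (LINT s:{0..t}|lborel. a s) \<bullet> b t \<partial>leb T) = (\<integral>t. p t \<bullet> b t \<partial>leb T) - p 0 \<bullet> integral\<^sup>L (leb T) b" .
  have "integral\<^sup>L (leb T) a \<bullet> integral\<^sup>L (leb T) b =
      (\<integral>t. a t \<bullet> z t \<partial>leb T) + ((\<integral>t. p t \<bullet> b t \<partial>leb T) - p 0 \<bullet> integral\<^sup>L (leb T) b)"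
  proof -
    have "(\<integral>t. a t \<bullet> (LINT s:{0..t}|lborel. b s) \<partial>leb T) = (\<integral>t. a t \<bullet> z t \<partial>leb T)"
      by (intro Bochner_Integration.integral_cong refl) (simp add: zt)
    with * show ?thesis
      unfolding integral_by_parts_zero[OF a b] by simp
  qed
  moreover have "p T = p 0 + integral\<^sup>L (leb T) a" "z T = integral\<^sup>L (leb T) b"
    using pt[of T] zt[of T] T unfolding LINT_leb by auto
  ultimately show ?thesis
    using i1 i2 by (simp add: inner_add_left)
qed

text \<open>Turns a vanishing L2 norm into equality at every time, endpoints included. The shooting
  argument reads it at t = 0, and uniqueness of the adjoint on all of [0,T].\<close>

lemma continuous_zero_of_square_integral:
  fixes f :: "real \<Rightarrow> 'b::euclidean_space"
  assumes f: "continuous_on {0..T} f" and T: "0 < T"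
    and "(\<integral>t. (norm (f t))\<^sup>2 \<partial>leb T) = 0" and t: "t \<in> {0..T}"
  shows "f t = 0"
proof -
  have c: "continuous_on {0..T} (\<lambda>t. (norm (f t))\<^sup>2)"
    by (intro continuous_intros f)
  have "integral {0..T} (\<lambda>t. (norm (f t))\<^sup>2) = 0"
    using set_borel_integral_eq_integral(2)[OF borel_integrable_atLeastAtMost'[OF c]] assms(3)
    by (simp add: LINT_leb)
  then have "(norm (f t))\<^sup>2 = 0"
    using integral_eq_0_iff[OF c T] t by simp
  then show ?thesis by simp
qed

section \<open>Fixed-time moments and pathwise Volterra solutions as processes\<close>

context brownian
begin

lemma L2F_AE_L2:
  assumes "L2F M W T x"
  shows "AE \<omega> in M. (\<lambda>t. x t \<omega>) \<in> L2 T"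
proof -
  interpret P: pair_sigma_finite "leb T" M by (rule pair_sigma_finite_leb)
  have "AE \<omega> in M. integrable (leb T) (\<lambda>t. (norm (x t \<omega>))\<^sup>2)"
    using assms by (intro P.AE_integrable_snd) (simp add: L2F_iff)
  then show ?thesis
    using AE_space
  proof eventually_elim
    case (elim \<omega>)
    then show ?case
      using assms progressive_path[of x \<omega>] by (simp add: L2_def L2F_iff)
  qed
qed

text \<open>\<open>L2F\<close> bounds second moments only for almost every time. For an integrated
  process the pathwise bound holds at each t, in particular at the terminal time.\<close>

lemma L2F_LINT_time:
  assumes x: "L2F M W T x" and t: "t \<in> {0..T}"
  shows "(\<lambda>\<omega>. LINT s:{0..t}|lborel. x s \<omega>) \<in> borel_measurable M"
    "integrable M (\<lambda>\<omega>. (norm (LINT s:{0..t}|lborel. x s \<omega>))\<^sup>2)"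
proof -
  interpret P: pair_sigma_finite "leb T" M by (rule pair_sigma_finite_leb)
  have px: "progressive x"
    using x by (simp add: L2F_iff)
  note [measurable] = progressive_measurable[OF px]
  show m [measurable]: "(\<lambda>\<omega>. LINT s:{0..t}|lborel. x s \<omega>) \<in> borel_measurable M"
    by (rule progressive_time[OF progressive_LINT[OF px] t])
  have "(\<integral>\<^sup>+\<omega>. ennreal ((norm (LINT s:{0..t}|lborel. x s \<omega>))\<^sup>2) \<partial>M)
      \<le> (\<integral>\<^sup>+\<omega>. ennreal T * (\<integral>\<^sup>+s. ennreal ((norm (x s \<omega>))\<^sup>2) \<partial>leb T) \<partial>M)"
    by (intro nn_integral_mono LINT_square_bound progressive_path[OF px] t)
  also have "\<dots> = ennreal T * (\<integral>\<^sup>+\<omega>. \<integral>\<^sup>+s. ennreal ((norm (x s \<omega>))\<^sup>2) \<partial>leb T \<partial>M)"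
    by (rule nn_integral_cmult) measurable
  also have "(\<integral>\<^sup>+\<omega>. \<integral>\<^sup>+s. ennreal ((norm (x s \<omega>))\<^sup>2) \<partial>leb T \<partial>M) =
      (\<integral>\<^sup>+z. (case z of (t, \<omega>) \<Rightarrow> ennreal ((norm (x t \<omega>))\<^sup>2)) \<partial>(leb T \<Otimes>\<^sub>M M))"
    by (subst P.nn_integral_snd[symmetric]) auto
  also have "ennreal T * \<dots> < \<infinity>"
    using x unfolding L2F_iff integrable_iff_bounded
    by (auto simp: ennreal_mult_less_top case_prod_unfold less_top)
  finally show "integrable M (\<lambda>\<omega>. (norm (LINT s:{0..t}|lborel. x s \<omega>))\<^sup>2)"
    unfolding integrable_iff_bounded by auto
qed

lemma L2F_inner:
  assumes "L2F M W T x" "L2F M W T y"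
  shows "integrable (leb T \<Otimes>\<^sub>M M) (\<lambda>(t, \<omega>). x t \<omega> \<bullet> y t \<omega>)"
  using integrable_inner_square[OF L2F_measurable[OF assms(1)] L2F_measurable[OF assms(2)]] assms
  by (simp add: L2F_iff case_prod_unfold)

text \<open>This is what the closed formula buys: sums, linear images, time-dependent linear maps
  and time integrals all preserve \<open>L2F\<close>. The range [-T,T] accommodates the inverse flow
  as well, and joint continuity makes both flows Borel in (t, v).\<close>

lemma L2F_volterra:
  fixes k :: "real \<Rightarrow> 'a \<Rightarrow> 'b::euclidean_space"
  assumes k: "L2F M W T k" and L: "linear L"
  shows "L2F M W T (\<lambda>t \<omega>. volterra L (\<lambda>t. k t \<omega>) t)"
proof -
  obtain C where C: "\<And>t v. t \<in> {-T..T} \<Longrightarrow> norm (propagator L t v) \<le> C * norm v"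
    using propagator_bounded[OF L] by blast
  have m: "(\<lambda>(t, v). propagator L t v) \<in> borel_measurable (borel \<Otimes>\<^sub>M borel)"
    "(\<lambda>(t, v). propagator L (- t) v) \<in> borel_measurable (borel \<Otimes>\<^sub>M borel)"
    unfolding borel_prod case_prod_unfold
    by (intro borel_measurable_continuous_onI propagator_continuous[OF L] continuous_intros)+
  show ?thesis
    unfolding volterra_def
    by (intro L2F_add k L2F_linear[OF _ L] L2F_map[OF _ m(1), of _ C] L2F_LINT L2F_map[OF _ m(2), of _ C])
      (auto intro!: C)
qed

end

subsection \<open>States and costs\<close>

locale control = brownian M W T
  for M :: "'a measure" and W :: "real \<Rightarrow> 'a \<Rightarrow> real^'n2" and T :: real +
  fixes A G Gam Q H :: "real^'n^'n" and B :: "real^'n1^'n" and D :: "real^'n2^'n"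
    and R :: "real^'n1^'n1" and \<eta> m0 x0 :: "real^'n" and \<gamma> :: real
    and u :: "real \<Rightarrow> 'a \<Rightarrow> real^'n1" and ubar :: "real \<Rightarrow> real^'n1"
  assumes gam: "\<gamma> > 0" and Q_sym: "transpose Q = Q" and H_sym: "transpose H = H"
    and u: "L2F M W T u" and ubar: "continuous_on {0..T} ubar"
begin

abbreviation "state \<equiv> is_state M W T A B G D x0 m0 u ubar"
abbreviation "J \<equiv> Jbar M W T A B G D Gam Q H R \<eta> \<gamma> x0 m0 u ubar"
abbreviation "ham \<equiv> ham_sol M W T A B G D Gam Q H \<eta> \<gamma> x0 m0 u ubar"
abbreviation "Qhat \<equiv> transpose (mat 1 - Gam) ** Q ** (mat 1 - Gam)"

lemma Q_inner: "x \<bullet> (Q *v y) = (Q *v x) \<bullet> y"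
  using transpose_inner[of Q x y] by (simp add: Q_sym)

lemma H_inner: "x \<bullet> (H *v y) = (H *v x) \<bullet> y"
  using transpose_inner[of H x y] by (simp add: H_sym)

text \<open>The right-hand sides are reassociated into a linear term plus one remainder, the shape
  \<open>L (y s) + h s\<close> of the Volterra and ODE lemmas.\<close>

lemma stateD:
  assumes "state f x m"
  shows "ode_sol T (\<lambda>s. (A + G) *v m s + (B *v ubar s + f s)) m" "m 0 = m0" "L2F M W T x"
    and "AE \<omega> in M. set_integrable lborel {0..T} (\<lambda>s. A *v x s \<omega> + (B *v u s \<omega> + (G *v m s + f s))) \<and>
        (\<forall>t\<in>{0..T}. x t \<omega> = x0 + (LINT s:{0..t}|lborel. A *v x s \<omega> + (B *v u s \<omega> + (G *v m s + f s)))
                                 + D *v W t \<omega>)"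
  using assms unfolding is_state_def add.assoc by blast+

lemma stateI:
  assumes "ode_sol T (\<lambda>s. (A + G) *v m s + (B *v ubar s + f s)) m" "m 0 = m0" "L2F M W T x"
    and "AE \<omega> in M. set_integrable lborel {0..T} (\<lambda>s. A *v x s \<omega> + (B *v u s \<omega> + (G *v m s + f s))) \<and>
        (\<forall>t\<in>{0..T}. x t \<omega> = x0 + (LINT s:{0..t}|lborel. A *v x s \<omega> + (B *v u s \<omega> + (G *v m s + f s)))
                                 + D *v W t \<omega>)"
  shows "state f x m"
  using assms unfolding is_state_def add.assoc by blast

text \<open>The equation for m does not contain x, so m comes first and then acts as given forcing;
  x is the pathwise Volterra solution for the linear part \<open>A\<close>.\<close>

lemma state_exists:
  assumes f: "f \<in> L2 T"
  obtains x m where "state f x m"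
proof -
  have "integrable (leb T) (\<lambda>s. B *v ubar s + f s)"
    by (intro Bochner_Integration.integrable_add L2_integrable[OF f] integrable_leb_continuous
        linear_continuous_on_compose[OF ubar linear_vec])
  then obtain m where m: "continuous_on {0..T} m" "m 0 = m0"
      "ode_sol T (\<lambda>s. (A + G) *v m s + (B *v ubar s + f s)) m"
    by (rule volterra_ode[OF linear_vec]) (use T_pos in auto)
  define r where "r s = G *v m s + f s" for s
  have r: "set_integrable lborel {0..T} r"
    unfolding set_integrable_leb r_def
    by (intro Bochner_Integration.integrable_add L2_integrable[OF f] integrable_leb_continuous
        linear_continuous_on_compose[OF m(1) linear_vec])
  define c where "c t = x0 + (LINT s:{0..t}|lborel. r s)" for t
  have c: "continuous_on {0..T} c"
    unfolding c_def by (intro continuous_intros continuous_on_LINT r)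
  define v where "v t \<omega> = (LINT s:{0..t}|lborel. B *v u s \<omega>)" for t \<omega>
  \<comment> \<open>Everything except the \<open>A *v x\<close> term goes into the forcing, the
    noise included. \<open>Wprog\<close> stands in for \<open>W\<close> so that \<open>k\<close>
    lies in \<open>L2F\<close>; the two are exchanged on almost every path at the end.\<close>
  define k where "k t \<omega> = c t + (v t \<omega> + D *v Wprog t \<omega>)" for t \<omega>
  define x where "x t \<omega> = volterra ((*v) A) (\<lambda>t. k t \<omega>) t" for t \<omega>
  have "L2F M W T k"
    unfolding k_def v_def
    by (intro L2F_add L2F_deterministic L2_continuous c L2F_LINT L2F_linear[OF u linear_vec]
        L2F_linear[OF L2F_Wprog linear_vec])
  then have x: "L2F M W T x"
    unfolding x_def by (intro L2F_volterra linear_vec)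
  have "AE \<omega> in M. set_integrable lborel {0..T} (\<lambda>s. A *v x s \<omega> + (B *v u s \<omega> + (G *v m s + f s))) \<and>
        (\<forall>t\<in>{0..T}. x t \<omega> = x0 + (LINT s:{0..t}|lborel. A *v x s \<omega> + (B *v u s \<omega> + (G *v m s + f s)))
                                 + D *v W t \<omega>)"
    using L2F_AE_L2[OF L2F_linear[OF u linear_vec[of B]]] Wprog_AE W_AE
  proof eventually_elim
    fix \<omega> assume Bu: "(\<lambda>t. B *v u t \<omega>) \<in> L2 T" and Wp: "\<forall>t\<ge>0. Wprog t \<omega> = W t \<omega>"
      and Wc: "W 0 \<omega> = 0 \<and> continuous_on {0..} (\<lambda>t. W t \<omega>)"
    have Bu': "set_integrable lborel {0..T} (\<lambda>t. B *v u t \<omega>)"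
      unfolding set_integrable_leb by (rule L2_integrable[OF Bu])
    have "continuous_on {0..T} (\<lambda>t. W t \<omega>)"
      by (rule continuous_on_subset[of "{0..}"]) (use Wc in auto)
    then have "continuous_on {0..T} (\<lambda>t. Wprog t \<omega>)"
      by (subst continuous_on_cong[OF refl, of _ _ "\<lambda>t. W t \<omega>"]) (use Wp in auto)
    then have k: "continuous_on {0..T} (\<lambda>t. k t \<omega>)"
      unfolding k_def v_def
      by (intro continuous_on_add c continuous_on_LINT Bu' linear_continuous_on_compose[OF _ linear_vec])
    have Ax: "set_integrable lborel {0..T} (\<lambda>s. A *v x s \<omega>)"
      unfolding set_integrable_leb x_def
      by (intro integrable_leb_continuous linear_continuous_on_compose[OF _ linear_vec]
          volterra_continuous[OF linear_vec k])
    have sum: "set_integrable lborel {0..t} (\<lambda>s. A *v x s \<omega>)" "set_integrable lborel {0..t} (\<lambda>s. B *v u s \<omega>)"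
      "set_integrable lborel {0..t} r" if "t \<in> {0..T}" for t
      by (rule set_integrable_subset[OF Ax] set_integrable_subset[OF Bu'] set_integrable_subset[OF r];
          use that in auto)+
    have "x t \<omega> = x0 + (LINT s:{0..t}|lborel. A *v x s \<omega> + (B *v u s \<omega> + r s)) + D *v W t \<omega>"
      if t: "t \<in> {0..T}" for t
    proof -
      have "x t \<omega> = k t \<omega> + (LINT s:{0..t}|lborel. A *v x s \<omega>)"
        unfolding x_def by (rule volterra_solves[OF linear_vec k t])
      also have "\<dots> = x0 + ((LINT s:{0..t}|lborel. A *v x s \<omega>) + ((LINT s:{0..t}|lborel. B *v u s \<omega>)
          + (LINT s:{0..t}|lborel. r s))) + D *v W t \<omega>"
        using Wp t by (simp add: k_def c_def v_def algebra_simps)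
      also have "\<dots> = x0 + (LINT s:{0..t}|lborel. A *v x s \<omega> + (B *v u s \<omega> + r s)) + D *v W t \<omega>"
        using set_integral_add[OF sum(2,3)[OF t]] set_integral_add(2)[OF sum(1)[OF t]] by simp
      finally show ?thesis .
    qed
    then show "set_integrable lborel {0..T} (\<lambda>s. A *v x s \<omega> + (B *v u s \<omega> + (G *v m s + f s))) \<and>
        (\<forall>t\<in>{0..T}. x t \<omega> = x0 + (LINT s:{0..t}|lborel. A *v x s \<omega> + (B *v u s \<omega> + (G *v m s + f s)))
                                 + D *v W t \<omega>)"
      using set_integral_add(1)[OF Ax set_integral_add(1)[OF Bu' r]] unfolding r_def by blast
  qed
  with m x show thesis
    by (intro that stateI)
qed

lemma state_continuous: "state f x m \<Longrightarrow> continuous_on {0..T} m"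
  using stateD(1) ode_sol_continuous by blast

text \<open>Two adjoints can be shown to agree on [0,T] only, so disturbances that differ outside
  this interval must be interchangeable.\<close>

lemma state_cong:
  assumes "state f x m" "\<And>t. t \<in> {0..T} \<Longrightarrow> f t = f' t"
  shows "state f' x m"
proof (rule stateI)
  show "ode_sol T (\<lambda>s. (A + G) *v m s + (B *v ubar s + f' s)) m"
    by (rule ode_sol_cong[OF _ stateD(1)[OF assms(1)]]) (simp add: assms(2))
  have L: "(LINT s:{0..t}|lborel. A *v x s \<omega> + (B *v u s \<omega> + (G *v m s + f s))) =
     (LINT s:{0..t}|lborel. A *v x s \<omega> + (B *v u s \<omega> + (G *v m s + f' s)))" if "t \<in> {0..T}" for t \<omega>
    by (rule LINT_cong_leb[OF _ that]) (simp add: assms(2))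
  have I: "set_integrable lborel {0..T} (\<lambda>s. A *v x s \<omega> + (B *v u s \<omega> + (G *v m s + f s))) =
     set_integrable lborel {0..T} (\<lambda>s. A *v x s \<omega> + (B *v u s \<omega> + (G *v m s + f' s)))" for \<omega>
    by (rule set_integrable_cong[OF refl refl]) (simp add: assms(2))
  show "AE \<omega> in M. set_integrable lborel {0..T} (\<lambda>s. A *v x s \<omega> + (B *v u s \<omega> + (G *v m s + f' s))) \<and>
        (\<forall>t\<in>{0..T}. x t \<omega> = x0 + (LINT s:{0..t}|lborel. A *v x s \<omega> + (B *v u s \<omega> + (G *v m s + f' s)))
                                 + D *v W t \<omega>)"
    using stateD(4)[OF assms(1)]
    by eventually_elim (unfold I, intro conjI ballI, blast, subst L[symmetric], assumption, blast)
qed (use stateD[OF assms(1)] in auto)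

text \<open>The mean field m is settled by its own equation. With m identified on [0,T], the two
  equations for x share the noise term and the remaining forcing path by path.\<close>

lemma state_unique:
  assumes s: "state f x m" "state f x' m'"
  shows "\<And>t. t \<in> {0..T} \<Longrightarrow> m' t = m t" "AE \<omega> in M. \<forall>t\<in>{0..T}. x' t \<omega> = x t \<omega>"
proof -
  show mm: "m' t = m t" if "t \<in> {0..T}" for t
    by (rule ode_sol_unique[OF linear_vec stateD(1)[OF s(1)] stateD(1)[OF s(2)] _ that])
      (simp add: stateD(2)[OF s(1)] stateD(2)[OF s(2)])
  have L: "(LINT s:{0..t}|lborel. A *v x' s \<omega> + (B *v u s \<omega> + (G *v m' s + f s))) =
     (LINT s:{0..t}|lborel. A *v x' s \<omega> + (B *v u s \<omega> + (G *v m s + f s)))" if "t \<in> {0..T}" for t \<omega>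
    by (rule LINT_cong_leb[OF _ that]) (simp add: mm)
  have I: "set_integrable lborel {0..T} (\<lambda>s. A *v x' s \<omega> + (B *v u s \<omega> + (G *v m' s + f s))) =
     set_integrable lborel {0..T} (\<lambda>s. A *v x' s \<omega> + (B *v u s \<omega> + (G *v m s + f s)))" for \<omega>
    by (rule set_integrable_cong[OF refl refl]) (simp add: mm)
  show "AE \<omega> in M. \<forall>t\<in>{0..T}. x' t \<omega> = x t \<omega>"
    using stateD(4)[OF s(1)] stateD(4)[OF s(2)]
  proof (eventually_elim, intro ballI)
    fix \<omega> t
    let ?h = "\<lambda>s. B *v u s \<omega> + (G *v m s + f s)"
    assume 1: "set_integrable lborel {0..T} (\<lambda>s. A *v x s \<omega> + ?h s) \<and>
        (\<forall>t\<in>{0..T}. x t \<omega> = x0 + (LINT s:{0..t}|lborel. A *v x s \<omega> + ?h s) + D *v W t \<omega>)"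
      and 2: "set_integrable lborel {0..T} (\<lambda>s. A *v x' s \<omega> + (B *v u s \<omega> + (G *v m' s + f s))) \<and>
        (\<forall>t\<in>{0..T}. x' t \<omega> = x0 + (LINT s:{0..t}|lborel. A *v x' s \<omega> + (B *v u s \<omega> + (G *v m' s + f s)))
                                 + D *v W t \<omega>)"
      and t: "t \<in> {0..T}"
    show "x' t \<omega> = x t \<omega>"
    proof (rule volterra_unique[OF linear_vec, where y = "\<lambda>t. x t \<omega>" and y' = "\<lambda>t. x' t \<omega>"
          and h = ?h and c = "\<lambda>t. x0 + D *v W t \<omega>", OF _ _ _ _ t])
      show "set_integrable lborel {0..T} (\<lambda>s. A *v x s \<omega> + ?h s)"
        using 1 by blast
      show "set_integrable lborel {0..T} (\<lambda>s. A *v x' s \<omega> + ?h s)"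
        using 2 unfolding I by blast
      show "x t \<omega> = x0 + D *v W t \<omega> + (LINT s:{0..t}|lborel. A *v x s \<omega> + ?h s)" if "t \<in> {0..T}" for t
        using 1[THEN conjunct2, rule_format, OF that] by (simp only: ac_simps)
      show "x' t \<omega> = x0 + D *v W t \<omega> + (LINT s:{0..t}|lborel. A *v x' s \<omega> + ?h s)" if "t \<in> {0..T}" for t
        using 2[THEN conjunct2, rule_format, OF that] unfolding L[OF that] by (simp only: ac_simps)
    qed
  qed
qed

text \<open>The shift adds A z + G z + g to the drift of x and (A + G) z + g to that of m. These
  coincide, so one and the same z absorbs both.\<close>

lemma state_shift:
  assumes s: "state f x m" and z: "ode_sol T (\<lambda>s. (A + G) *v z s + g s) z" "z 0 = 0"
  shows "state (\<lambda>t. f t + g t) (\<lambda>t \<omega>. x t \<omega> + z t) (\<lambda>t. m t + z t)"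
proof (rule stateI)
  show "ode_sol T (\<lambda>s. (A + G) *v (m s + z s) + (B *v ubar s + (f s + g s))) (\<lambda>t. m t + z t)"
    by (rule ode_sol_cong[OF _ ode_sol_add[OF stateD(1)[OF s] z(1)]]) (simp add: algebra_simps)
  show "m 0 + z 0 = m0"
    using z(2) stateD(2)[OF s] by simp
  show "L2F M W T (\<lambda>t \<omega>. x t \<omega> + z t)"
    by (intro L2F_add stateD(3)[OF s] L2F_deterministic L2_continuous ode_sol_continuous[OF z(1)])
  show "AE \<omega> in M. set_integrable lborel {0..T}
           (\<lambda>s. A *v (x s \<omega> + z s) + (B *v u s \<omega> + (G *v (m s + z s) + (f s + g s)))) \<and>
          (\<forall>t\<in>{0..T}. x t \<omega> + z t = x0 + (LINT s:{0..t}|lborel.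
              A *v (x s \<omega> + z s) + (B *v u s \<omega> + (G *v (m s + z s) + (f s + g s)))) + D *v W t \<omega>)"
    using stateD(4)[OF s]
  proof (eventually_elim, intro conjI ballI)
    fix \<omega>
    let ?r = "\<lambda>s. A *v x s \<omega> + (B *v u s \<omega> + (G *v m s + f s))"
    assume 1: "set_integrable lborel {0..T} ?r \<and>
        (\<forall>t\<in>{0..T}. x t \<omega> = x0 + (LINT s:{0..t}|lborel. ?r s) + D *v W t \<omega>)"
    note zi = ode_solD(1)[OF z(1)]
    have eq: "A *v (x s \<omega> + z s) + (B *v u s \<omega> + (G *v (m s + z s) + (f s + g s)))
        = ?r s + ((A + G) *v z s + g s)" for s
      by (simp add: algebra_simps)
    show "set_integrable lborel {0..T}
           (\<lambda>s. A *v (x s \<omega> + z s) + (B *v u s \<omega> + (G *v (m s + z s) + (f s + g s))))"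
      unfolding eq by (intro set_integral_add(1) zi conjunct1[OF 1])
    fix t assume t: "t \<in> {0..T}"
    have "set_integrable lborel {0..t} ?r" "set_integrable lborel {0..t} (\<lambda>s. (A + G) *v z s + g s)"
      by (rule set_integrable_subset[OF conjunct1[OF 1]] set_integrable_subset[OF zi]; use t in auto)+
    from set_integral_add(2)[OF this]
    show "x t \<omega> + z t = x0 + (LINT s:{0..t}|lborel.
              A *v (x s \<omega> + z s) + (B *v u s \<omega> + (G *v (m s + z s) + (f s + g s)))) + D *v W t \<omega>"
      unfolding eq using 1[THEN conjunct2, rule_format, OF t] ode_solD(2)[OF z(1) t] z(2)
      by simp
  qed
qed

lemma state_drift:
  assumes s: "state f x m" and f: "f \<in> L2 T"
  shows "L2F M W T (\<lambda>s \<omega>. A *v x s \<omega> + (B *v u s \<omega> + (G *v m s + f s)))"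
  by (intro L2F_add L2F_linear[OF _ linear_vec] L2F_deterministic L2_add L2_bounded_linear[OF _ linear_vec]
      stateD(3)[OF s] u f L2_continuous state_continuous[OF s])

text \<open>The terminal cost and the mean in the adjoint equation refer to fixed times, where
  \<open>L2F\<close> by itself gives no moment bound. The equation does: x(t) is a constant plus an
  integral plus \<open>D *v W t\<close>, each square integrable.\<close>

lemma state_time:
  assumes s: "state f x m" and f: "f \<in> L2 T" and t: "t \<in> {0..T}"
  shows "x t \<in> borel_measurable M" "integrable M (\<lambda>\<omega>. (norm (x t \<omega>))\<^sup>2)" "integrable M (x t)"
proof -
  define v where "v \<omega> = (LINT s:{0..t}|lborel. A *v x s \<omega> + (B *v u s \<omega> + (G *v m s + f s)))" for \<omega>
  have vm: "v \<in> borel_measurable M" and v2: "integrable M (\<lambda>\<omega>. (norm (v \<omega>))\<^sup>2)"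
    using L2F_LINT_time[OF state_drift[OF s f] t] unfolding v_def by auto
  show xm: "x t \<in> borel_measurable M"
    using stateD(3)[OF s] t by (intro progressive_time) (auto simp: L2F_iff)
  obtain K where K: "\<And>w. norm (D *v w) \<le> K * norm w"
    using linear_bounded_pos[OF linear_vec[of D]] by auto
  have "integrable M (\<lambda>\<omega>. 2 * (norm x0)\<^sup>2 + 2 * (2 * (norm (v \<omega>))\<^sup>2 + 2 * (K\<^sup>2 * (norm (W t \<omega>))\<^sup>2)))"
    using v2 W_square(1)[of t] t by simp
  then show x2: "integrable M (\<lambda>\<omega>. (norm (x t \<omega>))\<^sup>2)"
  proof (rule Bochner_Integration.integrable_bound)
    show "(\<lambda>\<omega>. (norm (x t \<omega>))\<^sup>2) \<in> borel_measurable M"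
      using xm by measurable
    show "AE \<omega> in M. norm ((norm (x t \<omega>))\<^sup>2)
        \<le> norm (2 * (norm x0)\<^sup>2 + 2 * (2 * (norm (v \<omega>))\<^sup>2 + 2 * (K\<^sup>2 * (norm (W t \<omega>))\<^sup>2)))"
      using stateD(4)[OF s]
    proof eventually_elim
      fix \<omega>
      assume "set_integrable lborel {0..T} (\<lambda>s. A *v x s \<omega> + (B *v u s \<omega> + (G *v m s + f s))) \<and>
        (\<forall>t\<in>{0..T}. x t \<omega> = x0 + (LINT s:{0..t}|lborel. A *v x s \<omega> + (B *v u s \<omega> + (G *v m s + f s)))
                                 + D *v W t \<omega>)"
      then have x: "x t \<omega> = x0 + (v \<omega> + D *v W t \<omega>)"
        using t unfolding v_def add.assoc by blast
      define q where "q = K\<^sup>2 * (norm (W t \<omega>))\<^sup>2"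
      have "(norm (D *v W t \<omega>))\<^sup>2 \<le> (K * norm (W t \<omega>))\<^sup>2"
        by (intro power_mono K norm_ge_zero)
      then have q: "(norm (D *v W t \<omega>))\<^sup>2 \<le> q"
        by (simp add: power_mult_distrib q_def)
      have arith: "n \<le> 2 * a + 2 * (2 * b + 2 * c)"
        if "n \<le> 2 * a + 2 * e" "e \<le> 2 * b + 2 * d" "d \<le> c" for n a b c d e :: real
        using that by auto
      have "(norm (x t \<omega>))\<^sup>2 \<le> 2 * (norm x0)\<^sup>2 + 2 * (2 * (norm (v \<omega>))\<^sup>2 + 2 * q)"
        unfolding x by (rule arith[OF norm_add_square_le norm_add_square_le q])
      also have "\<dots> \<le> norm \<dots>"
        unfolding real_norm_def by (rule abs_ge_self)
      finally show "norm ((norm (x t \<omega>))\<^sup>2)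
        \<le> norm (2 * (norm x0)\<^sup>2 + 2 * (2 * (norm (v \<omega>))\<^sup>2 + 2 * (K\<^sup>2 * (norm (W t \<omega>))\<^sup>2)))"
        unfolding q_def by simp
    qed
  qed
  show "integrable M (x t)"
    by (rule integrable_of_square[OF finite_measure_axioms xm x2])
qed

section \<open>The cost as an integral over time and probability\<close>

lemma state_error_L2F:
  assumes "state f x m"
  shows "L2F M W T (\<lambda>t \<omega>. x t \<omega> - (Gam *v m t + \<eta>))"
proof -
  have "L2F M W T (\<lambda>t \<omega>. x t \<omega> + - (Gam *v m t + \<eta>))"
    by (intro L2F_add stateD(3)[OF assms] L2F_deterministic L2_continuous continuous_intros
        linear_continuous_on_compose[OF state_continuous[OF assms] linear_vec])
  then show ?thesis unfolding diff_conv_add_uminus .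
qed

definition run :: "(real \<Rightarrow> 'a \<Rightarrow> real^'n) \<Rightarrow> (real \<Rightarrow> real^'n) \<Rightarrow> (real \<Rightarrow> real^'n) \<Rightarrow> real \<Rightarrow> 'a \<Rightarrow> real" where
  "run x m f t \<omega> = (x t \<omega> - (Gam *v m t + \<eta>)) \<bullet> (Q *v (x t \<omega> - (Gam *v m t + \<eta>)))
      + u t \<omega> \<bullet> (R *v u t \<omega>) - (1 / \<gamma>) * (norm (f t))\<^sup>2"

lemma run_integrable:
  assumes s: "state f x m" and f: "f \<in> L2 T"
  shows "integrable (leb T \<Otimes>\<^sub>M M) (\<lambda>(t, \<omega>). run x m f t \<omega>)"
  unfolding run_def case_prod_unfold
  by (intro Bochner_Integration.integrable_diff Bochner_Integration.integrable_add
      L2F_inner[unfolded case_prod_unfold] L2F_linear[OF _ linear_vec] state_error_L2F[OF s] u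
      integrable_mult_right integrable_pair_time[unfolded case_prod_unfold] L2_square[OF f])

lemma state_terminal_integrable:
  assumes s: "state f x m" and f: "f \<in> L2 T"
  shows "integrable M (\<lambda>\<omega>. x T \<omega> \<bullet> (H *v x T \<omega>))"
proof -
  note xT = state_time[OF s f, of T]
  have T: "T \<in> {0..T}" using T_pos by simp
  obtain K where K: "\<And>v. norm (H *v v) \<le> K * norm v"
    using linear_bounded_pos[OF linear_vec[of H]] by auto
  have mH: "(*v) H \<in> borel_measurable borel"
    by (intro borel_measurable_continuous_onI linear_continuous_on) (simp add: linear_vec linear_conv_bounded_linear[symmetric])
  have mHx: "(\<lambda>\<omega>. H *v x T \<omega>) \<in> borel_measurable M"
    by (rule measurable_compose[OF xT(1)[OF T] mH])
  show ?thesis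
  proof (rule integrable_inner_square[OF xT(1)[OF T] mHx xT(2)[OF T]])
    show "integrable M (\<lambda>\<omega>. (norm (H *v x T \<omega>))\<^sup>2)"
    proof (rule Bochner_Integration.integrable_bound)
      show "integrable M (\<lambda>\<omega>. K\<^sup>2 * (norm (x T \<omega>))\<^sup>2)"
        using xT(2)[OF T] by simp
      show "AE \<omega> in M. norm ((norm (H *v x T \<omega>))\<^sup>2) \<le> norm (K\<^sup>2 * (norm (x T \<omega>))\<^sup>2)"
        using power_mono[OF K norm_ge_zero, of _ 2] by (intro AE_I2) (simp add: power_mult_distrib)
    qed (use mHx in measurable)
  qed
qed

text \<open>The state chosen by \<open>SOME\<close> in the definition of the cost is indistinguishable from any other.\<close>
lemma J_eq:
  assumes s: "state f x m" and f: "f \<in> L2 T"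
  shows "J f = (\<integral>(t, \<omega>). run x m f t \<omega> \<partial>(leb T \<Otimes>\<^sub>M M)) + (\<integral>\<omega>. x T \<omega> \<bullet> (H *v x T \<omega>) \<partial>M)"
proof -
  interpret P: pair_sigma_finite "leb T" M by (rule pair_sigma_finite_leb)
  define xm where "xm = (SOME (x, m). state f x m)"
  obtain x' m' where xm: "xm = (x', m')" by (cases xm)
  have "case xm of (x, m) \<Rightarrow> state f x m"
    unfolding xm_def by (rule someI[of _ "(x, m)"]) (simp add: s)
  then have s': "state f x' m'" by (simp add: xm)
  note uniq = state_unique[OF s s']
  have T: "T \<in> {0..T}" using T_pos by simp
  have "J f = (\<integral>\<omega>. (LINT t:{0..T}|lborel. run x' m' f t \<omega>) \<partial>M) + (\<integral>\<omega>. x' T \<omega> \<bullet> (H *v x' T \<omega>) \<partial>M)"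
    unfolding Jbar_def run_def xm_def[symmetric] xm Let_def case_prod_conv ..
  also have "(\<integral>\<omega>. (LINT t:{0..T}|lborel. run x' m' f t \<omega>) \<partial>M) = (\<integral>\<omega>. (LINT t:{0..T}|lborel. run x m f t \<omega>) \<partial>M)"
    unfolding LINT_leb
  proof (rule integral_cong_AE)
    show "(\<lambda>\<omega>. \<integral>t. run x' m' f t \<omega> \<partial>leb T) \<in> borel_measurable M"
      "(\<lambda>\<omega>. \<integral>t. run x m f t \<omega> \<partial>leb T) \<in> borel_measurable M"
      using P.integrable_snd[OF run_integrable[OF s' f]] P.integrable_snd[OF run_integrable[OF s f]]
      by (auto intro: borel_measurable_integrable)
    show "AE \<omega> in M. (\<integral>t. run x' m' f t \<omega> \<partial>leb T) = (\<integral>t. run x m f t \<omega> \<partial>leb T)"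
      using uniq(2)
      by eventually_elim (intro Bochner_Integration.integral_cong refl, simp add: run_def uniq(1))
  qed
  \<comment> \<open>On the product measure the cost can later be expanded by linearity, with one
    integrability fact per term.\<close>
  also have "(\<integral>\<omega>. (LINT t:{0..T}|lborel. run x m f t \<omega>) \<partial>M) = (\<integral>(t, \<omega>). run x m f t \<omega> \<partial>(leb T \<Otimes>\<^sub>M M))"
    unfolding LINT_leb by (rule P.integral_snd[OF run_integrable[OF s f]])
  also have "(\<integral>\<omega>. x' T \<omega> \<bullet> (H *v x' T \<omega>) \<partial>M) = (\<integral>\<omega>. x T \<omega> \<bullet> (H *v x T \<omega>) \<partial>M)"
  proof (rule integral_cong_AE)
    show "AE \<omega> in M. x' T \<omega> \<bullet> (H *v x' T \<omega>) = x T \<omega> \<bullet> (H *v x T \<omega>)"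
      using uniq(2) by eventually_elim (use T in simp)
  qed (intro borel_measurable_integrable state_terminal_integrable[OF s' f] state_terminal_integrable[OF s f])+
  finally show ?thesis .
qed

end

subsection \<open>The Hamiltonian system\<close>

context control
begin

abbreviation "N \<equiv> mat 1 - Gam"

lemma Qhat_inner: "y \<bullet> (Qhat *v z) = (N *v y) \<bullet> (Q *v (N *v z))"
proof -
  have "Qhat *v z = transpose N *v (Q *v (N *v z))"
    by (simp add: matrix_vector_mul_assoc matrix_mul_assoc)
  then show ?thesis
    using transpose_inner[of N "Q *v (N *v z)" y] by (simp add: inner_commute)
qed

text \<open>The first variation pairs the random tracking error with the deterministic function Q (I
  - Gam) z, so only its expectation survives. This is the bracket that drives the adjoint
  equation.\<close>

definition mean_error :: "(real \<Rightarrow> 'a \<Rightarrow> real^'n) \<Rightarrow> (real \<Rightarrow> real^'n) \<Rightarrow> real \<Rightarrow> real^'n" where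
  "mean_error x m t = (\<integral>\<omega>. x t \<omega> \<partial>M) - (Gam *v m t + \<eta>)"

lemma mean_error_eq:
  assumes "state f x m" "f \<in> L2 T" "t \<in> {0..T}"
  shows "(\<integral>\<omega>. x t \<omega> - (Gam *v m t + \<eta>) \<partial>M) = mean_error x m t"
    "integrable M (\<lambda>\<omega>. x t \<omega> - (Gam *v m t + \<eta>))"
  using state_time(3)[OF assms] by (simp_all add: mean_error_def prob_space)

lemma mean_error_integrable:
  assumes s: "state f x m" and f: "f \<in> L2 T"
  shows "integrable (leb T) (mean_error x m)"
proof -
  interpret P: pair_sigma_finite "leb T" M by (rule pair_sigma_finite_leb)
  note e = state_error_L2F[OF s]
  have fin: "finite_measure (leb T \<Otimes>\<^sub>M M)"
    by (rule finite_measure_pair_measure[OF finite_measure_axioms finite_measure_leb])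
  have "integrable (leb T \<Otimes>\<^sub>M M) (\<lambda>(t, \<omega>). x t \<omega> - (Gam *v m t + \<eta>))"
    using integrable_of_square[OF fin L2F_measurable[OF e]] e by (simp add: L2F_iff case_prod_unfold)
  from P.integrable_fst[OF this] show ?thesis
    by (rule Bochner_Integration.integrable_cong[THEN iffD1, rotated 2])
      (simp_all add: mean_error_eq[OF s f])
qed

lemma cross_term:
  assumes s: "state f x m" and f: "f \<in> L2 T" and z: "continuous_on {0..T} z"
  shows "integrable (leb T \<Otimes>\<^sub>M M) (\<lambda>(t, \<omega>). (Q *v (N *v z t)) \<bullet> (x t \<omega> - (Gam *v m t + \<eta>)))"
    and "(\<integral>(t, \<omega>). (Q *v (N *v z t)) \<bullet> (x t \<omega> - (Gam *v m t + \<eta>)) \<partial>(leb T \<Otimes>\<^sub>M M))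
       = (\<integral>t. (Q *v (N *v z t)) \<bullet> mean_error x m t \<partial>leb T)"
    and "integrable (leb T) (\<lambda>t. (Q *v (N *v z t)) \<bullet> mean_error x m t)"
proof -
  interpret P: pair_sigma_finite "leb T" M by (rule pair_sigma_finite_leb)
  have c: "continuous_on {0..T} (\<lambda>t. Q *v (N *v z t))"
    by (intro linear_continuous_on_compose[OF _ linear_vec] z)
  show i: "integrable (leb T \<Otimes>\<^sub>M M) (\<lambda>(t, \<omega>). (Q *v (N *v z t)) \<bullet> (x t \<omega> - (Gam *v m t + \<eta>)))"
    by (intro L2F_inner L2F_deterministic L2_continuous c state_error_L2F[OF s])
  have eq: "(\<integral>\<omega>. (Q *v (N *v z t)) \<bullet> (x t \<omega> - (Gam *v m t + \<eta>)) \<partial>M) = (Q *v (N *v z t)) \<bullet> mean_error x m t"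
    if "t \<in> {0..T}" for t
    using mean_error_eq[OF s f that] by (subst integral_inner_right) simp_all
  show "(\<integral>(t, \<omega>). (Q *v (N *v z t)) \<bullet> (x t \<omega> - (Gam *v m t + \<eta>)) \<partial>(leb T \<Otimes>\<^sub>M M))
       = (\<integral>t. (Q *v (N *v z t)) \<bullet> mean_error x m t \<partial>leb T)"
    unfolding P.integral_fst[OF i, symmetric]
    by (intro Bochner_Integration.integral_cong refl eq) simp
  show "integrable (leb T) (\<lambda>t. (Q *v (N *v z t)) \<bullet> mean_error x m t)"
    by (rule Bochner_Integration.integrable_cong[THEN iffD1, OF refl _ P.integrable_fst[OF i]])
      (simp add: eq)
qed

lemma integral_pair_time:
  fixes d :: "real \<Rightarrow> real"
  assumes "integrable (leb T) d"
  shows "(\<integral>(t, \<omega>). d t \<partial>(leb T \<Otimes>\<^sub>M M)) = integral\<^sup>L (leb T) d"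
proof -
  interpret P: pair_sigma_finite "leb T" M by (rule pair_sigma_finite_leb)
  show ?thesis
    using P.integral_fst[OF integrable_pair_time[OF assms]] by (simp add: prob_space)
qed

text \<open>The dynamics are affine and the cost is quadratic, so the expansion is exact. The
  tracking error x - Gam m - \<eta> moves by z - Gam z = \<open>N *v z\<close>, which is the origin
  of \<open>Qhat\<close>; the control term is unchanged.\<close>

lemma J_shift:
  assumes s: "state f x m" and f: "f \<in> L2 T" and g: "g \<in> L2 T"
    and z: "ode_sol T (\<lambda>s. (A + G) *v z s + g s) z" "z 0 = 0"
  shows "J (\<lambda>t. f t + g t) = J f + 2 * (\<integral>t. (Q *v (N *v z t)) \<bullet> mean_error x m t \<partial>leb T)
     + 2 * ((H *v z T) \<bullet> (\<integral>\<omega>. x T \<omega> \<partial>M)) - (2 / \<gamma>) * (\<integral>t. f t \<bullet> g t \<partial>leb T) - Jpp T Qhat H \<gamma> g z"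
proof -
  interpret P: pair_sigma_finite "leb T" M by (rule pair_sigma_finite_leb)
  have T: "T \<in> {0..T}" using T_pos by simp
  note zc = ode_sol_continuous[OF z(1)]
  note s' = state_shift[OF s z]
  \<comment> \<open>The deterministic second-order part of the running cost; J''(g) is minus its
    integral minus the terminal form at z(T).\<close>
  define d where "d t = (N *v z t) \<bullet> (Q *v (N *v z t)) - (1 / \<gamma>) * (norm (g t))\<^sup>2" for t
  define c where "c t \<omega> = (Q *v (N *v z t)) \<bullet> (x t \<omega> - (Gam *v m t + \<eta>))" for t \<omega>
  note cross = cross_term[OF s f zc, folded c_def]
  have d1: "integrable (leb T) (\<lambda>t. (N *v z t) \<bullet> (Q *v (N *v z t)))"
    by (intro integrable_leb_continuous continuous_intros linear_continuous_on_compose[OF _ linear_vec] zc)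
  have d: "integrable (leb T) d"
    unfolding d_def by (intro Bochner_Integration.integrable_diff d1 integrable_mult_right L2_square[OF g])
  have fg: "integrable (leb T) (\<lambda>t. (2 / \<gamma>) * (f t \<bullet> g t))"
    by (intro integrable_mult_right integrable_inner_square L2_measurable L2_square f g)
  have e: "x t \<omega> + z t - (Gam *v (m t + z t) + \<eta>) = (x t \<omega> - (Gam *v m t + \<eta>)) + N *v z t" for t \<omega>
    by (simp add: algebra_simps matrix_vector_mult_diff_rdistrib)
  have quad: "(a + b) \<bullet> (Q *v (a + b)) = a \<bullet> (Q *v a) + 2 * ((Q *v b) \<bullet> a) + b \<bullet> (Q *v b)" for a b
    using Q_inner[of b a] by (simp add: inner_add_left inner_add_right matrix_vector_right_distrib inner_commute)
  have sq: "(norm (f t + g t))\<^sup>2 = (norm (f t))\<^sup>2 + 2 * (f t \<bullet> g t) + (norm (g t))\<^sup>2" for t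
    unfolding power2_norm_eq_inner by (simp add: inner_add_left inner_add_right inner_commute)
  have run: "run (\<lambda>t \<omega>. x t \<omega> + z t) (\<lambda>t. m t + z t) (\<lambda>t. f t + g t) t \<omega>
     = run x m f t \<omega> + 2 * c t \<omega> + (d t - (2 / \<gamma>) * (f t \<bullet> g t))" for t \<omega>
    unfolding run_def e quad sq c_def d_def by (simp add: algebra_simps add_divide_distrib)
  have "(\<integral>(t, \<omega>). run (\<lambda>t \<omega>. x t \<omega> + z t) (\<lambda>t. m t + z t) (\<lambda>t. f t + g t) t \<omega> \<partial>(leb T \<Otimes>\<^sub>M M))
    = (\<integral>(t, \<omega>). run x m f t \<omega> \<partial>(leb T \<Otimes>\<^sub>M M)) + 2 * (\<integral>(t, \<omega>). c t \<omega> \<partial>(leb T \<Otimes>\<^sub>M M))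
      + (\<integral>(t, \<omega>). d t - (2 / \<gamma>) * (f t \<bullet> g t) \<partial>(leb T \<Otimes>\<^sub>M M))"
    unfolding run using run_integrable[OF s f] cross(1)
      integrable_pair_time[OF Bochner_Integration.integrable_diff[OF d fg]]
    by (simp add: case_prod_unfold)
  also have "(\<integral>(t, \<omega>). d t - (2 / \<gamma>) * (f t \<bullet> g t) \<partial>(leb T \<Otimes>\<^sub>M M))
      = integral\<^sup>L (leb T) d - (2 / \<gamma>) * (\<integral>t. f t \<bullet> g t \<partial>leb T)"
    using integral_pair_time[OF Bochner_Integration.integrable_diff[OF d fg]] d fg by simp
  finally have 1: "(\<integral>(t, \<omega>). run (\<lambda>t \<omega>. x t \<omega> + z t) (\<lambda>t. m t + z t) (\<lambda>t. f t + g t) t \<omega> \<partial>(leb T \<Otimes>\<^sub>M M))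
    = (\<integral>(t, \<omega>). run x m f t \<omega> \<partial>(leb T \<Otimes>\<^sub>M M)) + 2 * (\<integral>t. (Q *v (N *v z t)) \<bullet> mean_error x m t \<partial>leb T)
      + (integral\<^sup>L (leb T) d - (2 / \<gamma>) * (\<integral>t. f t \<bullet> g t \<partial>leb T))"
    unfolding cross(2) .
  have quadH: "(a + b) \<bullet> (H *v (a + b)) = a \<bullet> (H *v a) + 2 * ((H *v b) \<bullet> a) + b \<bullet> (H *v b)" for a b
    using H_inner[of b a] by (simp add: inner_add_left inner_add_right matrix_vector_right_distrib inner_commute)
  have Hx: "integrable M (\<lambda>\<omega>. (H *v z T) \<bullet> x T \<omega>)"
    by (rule integrable_inner_right[OF state_time(3)[OF s f T]])
  have 2: "(\<integral>\<omega>. (x T \<omega> + z T) \<bullet> (H *v (x T \<omega> + z T)) \<partial>M)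
     = (\<integral>\<omega>. x T \<omega> \<bullet> (H *v x T \<omega>) \<partial>M) + 2 * ((H *v z T) \<bullet> (\<integral>\<omega>. x T \<omega> \<partial>M)) + z T \<bullet> (H *v z T)"
    unfolding quadH using state_terminal_integrable[OF s f] Hx
    by (simp add: prob_space state_time(3)[OF s f T])
  have "(\<integral>t. - (z t \<bullet> (Qhat *v z t)) + (1 / \<gamma>) * (norm (g t))\<^sup>2 \<partial>leb T) = (\<integral>t. - d t \<partial>leb T)"
    unfolding d_def Qhat_inner by simp
  then have 3: "Jpp T Qhat H \<gamma> g z = - integral\<^sup>L (leb T) d - z T \<bullet> (H *v z T)"
    unfolding Jpp_def LINT_leb by simp
  show ?thesis
    unfolding J_eq[OF s' L2_add[OF f g]] J_eq[OF s f] 1 2 3 by (simp only: algebra_simps)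
qed

section \<open>Stationarity, existence and uniqueness for the Hamiltonian system\<close>

lemma hamD:
  assumes "ham x m p"
  shows "state (\<lambda>t. \<gamma> *\<^sub>R p t) x m"
    and "ode_sol T (\<lambda>s. - (transpose (A + G) *v p s) - transpose N *v (Q *v mean_error x m s)) p"
    and "p T = H *v (\<integral>\<omega>. x T \<omega> \<partial>M)"
  using assms unfolding ham_sol_def is_state_def mean_error_def by blast+

lemma hamI:
  assumes s: "state (\<lambda>t. \<gamma> *\<^sub>R p t) x m"
    and p: "ode_sol T (\<lambda>s. - (transpose (A + G) *v p s) - transpose N *v (Q *v mean_error x m s)) p"
    and pT: "p T = H *v (\<integral>\<omega>. x T \<omega> \<partial>M)"
  shows "ham x m p"
  using assms L2_continuous[OF state_continuous[OF s]] L2_continuous[OF ode_sol_continuous[OF p]]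
  unfolding ham_sol_def is_state_def mean_error_def by blast

lemma ham_continuous: "ham x m p \<Longrightarrow> continuous_on {0..T} p"
  using hamD(2) ode_sol_continuous by blast

lemma ham_L2: "ham x m p \<Longrightarrow> (\<lambda>t. \<gamma> *\<^sub>R p t) \<in> L2 T"
  by (intro L2_continuous continuous_intros ham_continuous)

text \<open>The adjoint equation cancels the first variation, so only the second variation remains.\<close>
lemma ham_stationary:
  assumes h: "ham x m p" and g: "g \<in> L2 T"
    and z: "ode_sol T (\<lambda>s. (A + G) *v z s + g s) z" "z 0 = 0"
  shows "J (\<lambda>t. \<gamma> *\<^sub>R p t + g t) = J (\<lambda>t. \<gamma> *\<^sub>R p t) - Jpp T Qhat H \<gamma> g z"
proof -
  note s = hamD(1)[OF h] and f = ham_L2[OF h]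
  note zc = ode_sol_continuous[OF z(1)]
  have c: "integrable (leb T) (\<lambda>t. (Q *v (N *v z t)) \<bullet> mean_error x m t)"
    by (rule cross_term(3)[OF s f zc])
  have pg: "integrable (leb T) (\<lambda>t. p t \<bullet> g t)"
    using integrable_inner_continuous[OF L2_integrable[OF g] ham_continuous[OF h]]
    by (simp add: inner_commute)
  \<comment> \<open>The terms with A + G cancel against each other. The terminal condition on p
    turns the left side into the terminal part of the first variation.\<close>
  have "p T \<bullet> z T = (\<integral>t. (- (transpose (A + G) *v p t) - transpose N *v (Q *v mean_error x m t)) \<bullet> z t
      + p t \<bullet> ((A + G) *v z t + g t) \<partial>leb T)"
    by (rule ode_sol_by_parts[OF hamD(2)[OF h] z]) (use T_pos in simp)
  also have "\<dots> = (\<integral>t. p t \<bullet> g t - (Q *v (N *v z t)) \<bullet> mean_error x m t \<partial>leb T)"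
  proof (intro Bochner_Integration.integral_cong refl)
    fix t
    have "(transpose N *v (Q *v mean_error x m t)) \<bullet> z t = (Q *v (N *v z t)) \<bullet> mean_error x m t"
      unfolding transpose_inner using Q_inner[of "N *v z t" "mean_error x m t"] by (simp add: inner_commute)
    then show "(- (transpose (A + G) *v p t) - transpose N *v (Q *v mean_error x m t)) \<bullet> z t
      + p t \<bullet> ((A + G) *v z t + g t) = p t \<bullet> g t - (Q *v (N *v z t)) \<bullet> mean_error x m t"
      using transpose_inner[of "A + G" "p t" "z t"]
      by (simp add: inner_diff_left inner_minus_left inner_add_right)
  qed
  also have "\<dots> = (\<integral>t. p t \<bullet> g t \<partial>leb T) - (\<integral>t. (Q *v (N *v z t)) \<bullet> mean_error x m t \<partial>leb T)"
    by (rule Bochner_Integration.integral_diff[OF pg c])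
  finally have "(H *v z T) \<bullet> (\<integral>\<omega>. x T \<omega> \<partial>M) = \<dots>"
    unfolding hamD(3)[OF h] using H_inner[of "z T" "\<integral>\<omega>. x T \<omega> \<partial>M"] by (simp add: inner_commute)
  \<comment> \<open>Here the factor in f = \<gamma> p is decisive: it balances the weight 1/\<gamma>
    of the disturbance penalty.\<close>
  moreover have "(2 / \<gamma>) * (\<integral>t. \<gamma> *\<^sub>R p t \<bullet> g t \<partial>leb T) = 2 * (\<integral>t. p t \<bullet> g t \<partial>leb T)"
    using gam by simp
  ultimately show ?thesis
    unfolding J_shift[OF s f g z] by simp
qed

lemma L2norm2_nonneg: "0 \<le> L2norm2 T g"
  unfolding L2norm2_def LINT_leb by simp

text \<open>Shooting on \<open>p 0\<close>: coercivity makes the boundary map injective, hence onto.\<close>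
lemma ham_exists:
  assumes H1: "H1 T A G Gam Q H \<gamma>"
  obtains x m p where "ham x m p"
proof -
  have T: "T \<in> {0..T}" "0 \<in> {0..T}" "0 \<le> T" using T_pos by simp_all
  obtain \<epsilon> where \<epsilon>: "\<epsilon> > 0" "\<And>g z. g \<in> L2 T \<Longrightarrow> ode_sol T (\<lambda>s. (A + G) *v z s + g s) z \<Longrightarrow> z 0 = 0 \<Longrightarrow>
      \<epsilon> * L2norm2 T g \<le> Jpp T Qhat H \<gamma> g z"
    using H1 unfolding H1_def by blast
  have zero: "(\<lambda>t. 0) \<in> L2 T"
    by (intro L2_continuous continuous_intros)
  obtain x m where s: "state (\<lambda>t. 0) x m"
    by (rule state_exists[OF zero])
  \<comment> \<open>The source of the adjoint equation along the undisturbed state. Shifting by z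
    changes the mean error by \<open>N *v z\<close>, so the source becomes k +
    \<open>Qhat *v z\<close>.\<close>
  define k where "k t = transpose N *v (Q *v mean_error x m t)" for t
  have k: "integrable (leb T) k"
    using mean_error_integrable[OF s zero] unfolding k_def set_integrable_leb[symmetric]
    by (intro LINT_linear(2)[OF linear_vec])
  \<comment> \<open>The Hamiltonian block operator acting on the pair (z, p).\<close>
  define L where "L y = ((A + G) *v fst y + \<gamma> *\<^sub>R snd y, - (transpose (A + G) *v snd y) - Qhat *v fst y)"
    for y :: "(real^'n) \<times> (real^'n)"
  have L: "linear L"
  proof (rule linearI)
    show "L (y + y') = L y + L y'" for y y'
      by (simp add: L_def matrix_vector_right_distrib scaleR_right_distrib del: transpose_matrix_vector)
    show "L (a *\<^sub>R y) = a *\<^sub>R L y" for a y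
      by (simp add: L_def matrix_vector_mult_scaleR scaleR_right_distrib scaleR_right_diff_distrib
          mult.commute[of a] del: transpose_matrix_vector)
  qed
  have "linear (\<lambda>v::real^'n. (0::real^'n, - v))"
    by (rule linearI) simp_all
  then have "integrable (leb T) (\<lambda>s. (0::real^'n, - k s))"
    using k unfolding set_integrable_leb[symmetric] by (rule LINT_linear(2))
  \<comment> \<open>A particular solution with zero initial data. The homogeneous solutions
    \<open>E q\<close> start at (0, q), so \<open>Y + E q\<close> runs through the solutions with
    z(0) = 0 and p(0) = q.\<close>
  then obtain Y where Y: "continuous_on {0..T} Y" "Y 0 = 0" "ode_sol T (\<lambda>s. L (Y s) + (0, - k s)) Y"
    by (rule volterra_ode[OF L]) (use T in auto)
  define E where "E q t = propagator L t (0::real^'n, q)" for q t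
  have E: "ode_sol T (\<lambda>s. L (E q s)) (E q)" and E0: "E q 0 = (0, q)" for q
    unfolding E_def by (rule propagator_ode_sol[OF L] propagator_0)+
  \<comment> \<open>The defect of \<open>E q\<close> in the homogeneous terminal condition p(T) = H
    z(T).\<close>
  define \<Lambda> where "\<Lambda> q = snd (E q T) - H *v fst (E q T)" for q
  have \<Lambda>: "linear \<Lambda>"
  proof (rule linearI)
    have "E (q + q') T = E q T + E q' T" for q q'
      using linear_add[OF propagator_linear[OF L], of T "(0, q)" "(0, q')"] by (simp add: E_def)
    then show "\<Lambda> (q + q') = \<Lambda> q + \<Lambda> q'" for q q'
      by (simp add: \<Lambda>_def matrix_vector_right_distrib)
    have "E (a *\<^sub>R q) T = a *\<^sub>R E q T" for a q
      using linear_scale[OF propagator_linear[OF L], of T a "(0, q)"] by (simp add: E_def)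
    then show "\<Lambda> (a *\<^sub>R q) = a *\<^sub>R \<Lambda> q" for a q
      by (simp add: \<Lambda>_def matrix_vector_mult_scaleR scaleR_right_diff_distrib)
  qed
  \<comment> \<open>In the kernel, integration by parts of p . z gives J''(\<gamma> p) = 0.
    Coercivity then makes p vanish almost everywhere, and by continuity also at 0, where p is
    q.\<close>
  have "q = 0" if q: "\<Lambda> q = 0" for q
  proof -
    define z where "z t = fst (E q t)" for t
    define p where "p t = snd (E q t)" for t
    have z: "ode_sol T (\<lambda>s. (A + G) *v z s + \<gamma> *\<^sub>R p s) z"
      using ode_sol_linear[OF linear_fst E] unfolding L_def z_def p_def by simp
    have p: "ode_sol T (\<lambda>s. - (transpose (A + G) *v p s) - Qhat *v z s) p"
      using ode_sol_linear[OF linear_snd E] unfolding L_def z_def p_def by simp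
    note c = ode_sol_continuous[OF z] ode_sol_continuous[OF p]
    have z0: "z 0 = 0" and p0: "p 0 = q"
      by (simp_all add: z_def p_def E0)
    have pT: "p T = H *v z T"
      using q by (simp add: \<Lambda>_def z_def p_def)
    have g: "(\<lambda>t. \<gamma> *\<^sub>R p t) \<in> L2 T"
      by (intro L2_continuous continuous_intros c)
    have "p T \<bullet> z T = (\<integral>t. (- (transpose (A + G) *v p t) - Qhat *v z t) \<bullet> z t
        + p t \<bullet> ((A + G) *v z t + \<gamma> *\<^sub>R p t) \<partial>leb T)"
      by (rule ode_sol_by_parts[OF p z z0 T(3)])
    also have "\<dots> = (\<integral>t. - (z t \<bullet> (Qhat *v z t)) + (1 / \<gamma>) * (norm (\<gamma> *\<^sub>R p t))\<^sup>2 \<partial>leb T)"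
    proof (intro Bochner_Integration.integral_cong refl)
      fix t
      have "(1 / \<gamma>) * (norm (\<gamma> *\<^sub>R p t))\<^sup>2 = \<gamma> * (p t \<bullet> p t)"
        unfolding power2_norm_eq_inner using gam by simp
      then show "(- (transpose (A + G) *v p t) - Qhat *v z t) \<bullet> z t
        + p t \<bullet> ((A + G) *v z t + \<gamma> *\<^sub>R p t) = - (z t \<bullet> (Qhat *v z t)) + (1 / \<gamma>) * (norm (\<gamma> *\<^sub>R p t))\<^sup>2"
        unfolding inner_diff_left inner_minus_left inner_add_right inner_scaleR_right
          transpose_inner inner_commute[of "Qhat *v z t" "z t"]
        using gam by (simp add: power2_norm_eq_inner)
    qed
    finally have "Jpp T Qhat H \<gamma> (\<lambda>t. \<gamma> *\<^sub>R p t) z = 0"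
      unfolding Jpp_def LINT_leb pT by (simp add: inner_commute[of "H *v z T"])
    then have "\<epsilon> * L2norm2 T (\<lambda>t. \<gamma> *\<^sub>R p t) \<le> 0"
      using \<epsilon>(2)[OF g z z0] by simp
    then have "L2norm2 T (\<lambda>t. \<gamma> *\<^sub>R p t) = 0"
      using \<epsilon>(1) L2norm2_nonneg[of "\<lambda>t. \<gamma> *\<^sub>R p t"] by (simp add: mult_le_0_iff)
    then have "(\<integral>t. (norm (\<gamma> *\<^sub>R p t))\<^sup>2 \<partial>leb T) = 0"
      unfolding L2norm2_def LINT_leb .
    moreover have "continuous_on {0..T} (\<lambda>t. \<gamma> *\<^sub>R p t)"
      by (intro continuous_intros c)
    ultimately have "\<gamma> *\<^sub>R p 0 = 0"
      using continuous_zero_of_square_integral[OF _ T_pos _ T(2)] by blast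
    then show "q = 0"
      using gam p0 by simp
  qed
  then have "inj \<Lambda>"
    using linear_injective_0[OF \<Lambda>] by blast
  then have "surj \<Lambda>"
    by (rule linear_injective_imp_surjective[OF \<Lambda> _ refl])
  \<comment> \<open>The right side is dictated by p(T) = H (E x(T) + z(T)) for (z, p) =
    \<open>Y + E q\<close>.\<close>
  then obtain q where q: "\<Lambda> q = H *v (\<integral>\<omega>. x T \<omega> \<partial>M) - (snd (Y T) - H *v fst (Y T))"
    by (metis surjD)
  define z where "z t = fst (Y t + E q t)" for t
  define p where "p t = snd (Y t + E q t)" for t
  have zp: "ode_sol T (\<lambda>s. L (Y s + E q s) + (0, - k s)) (\<lambda>t. Y t + E q t)"
    by (rule ode_sol_cong[OF _ ode_sol_add[OF Y(3) E]]) (simp add: linear_add[OF L])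
  have z: "ode_sol T (\<lambda>s. (A + G) *v z s + \<gamma> *\<^sub>R p s) z"
    using ode_sol_linear[OF linear_fst zp] unfolding L_def z_def p_def by simp
  have p: "ode_sol T (\<lambda>s. - (transpose (A + G) *v p s) - Qhat *v z s - k s) p"
    using ode_sol_linear[OF linear_snd zp] unfolding L_def z_def p_def by simp
  have z0: "z 0 = 0"
    by (simp add: z_def Y(2) E0)
  have mean: "(\<integral>\<omega>. x t \<omega> + z t \<partial>M) = (\<integral>\<omega>. x t \<omega> \<partial>M) + z t" if "t \<in> {0..T}" for t
    using state_time(3)[OF s zero that] by (simp add: prob_space)
  have "ham (\<lambda>t \<omega>. x t \<omega> + z t) (\<lambda>t. m t + z t) p"
  proof (rule hamI)
    show "state (\<lambda>t. \<gamma> *\<^sub>R p t) (\<lambda>t \<omega>. x t \<omega> + z t) (\<lambda>t. m t + z t)"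
      using state_shift[OF s z z0] by simp
    show "p T = H *v (\<integral>\<omega>. x T \<omega> + z T \<partial>M)"
      using q unfolding mean[OF T(1)] unfolding \<Lambda>_def p_def z_def
      by (simp add: matrix_vector_right_distrib algebra_simps)
    show "ode_sol T (\<lambda>s. - (transpose (A + G) *v p s)
        - transpose N *v (Q *v mean_error (\<lambda>t \<omega>. x t \<omega> + z t) (\<lambda>t. m t + z t) s)) p"
    proof (rule ode_sol_cong[OF _ p])
      fix t assume t: "t \<in> {0..T}"
      have "mean_error (\<lambda>t \<omega>. x t \<omega> + z t) (\<lambda>t. m t + z t) t = mean_error x m t + N *v z t"
        unfolding mean_error_def mean[OF t] by (simp add: algebra_simps)
      then show "- (transpose (A + G) *v p t) - Qhat *v z t - k t = - (transpose (A + G) *v p t)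
        - transpose N *v (Q *v mean_error (\<lambda>t \<omega>. x t \<omega> + z t) (\<lambda>t. m t + z t) t)"
        by (simp add: k_def matrix_vector_right_distrib matrix_vector_mul_assoc matrix_mul_assoc)
    qed
  qed
  then show thesis
    by (rule that)
qed

text \<open>Stationarity is applied with g = f - \<gamma> p. Keeping the quadratic gap from (H1),
  rather than a bare inequality, is what later yields uniqueness.\<close>

lemma ham_strict_maximizer:
  assumes H1: "H1 T A G Gam Q H \<gamma>" and h: "ham x m p"
  obtains \<epsilon> where "\<epsilon> > 0"
    "\<And>f. f \<in> L2 T \<Longrightarrow> J f + \<epsilon> * L2norm2 T (\<lambda>t. f t - \<gamma> *\<^sub>R p t) \<le> J (\<lambda>t. \<gamma> *\<^sub>R p t)"
proof -
  obtain \<epsilon> where \<epsilon>: "\<epsilon> > 0" "\<And>g z. g \<in> L2 T \<Longrightarrow> ode_sol T (\<lambda>s. (A + G) *v z s + g s) z \<Longrightarrow> z 0 = 0 \<Longrightarrow>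
      \<epsilon> * L2norm2 T g \<le> Jpp T Qhat H \<gamma> g z"
    using H1 unfolding H1_def by blast
  have "J f + \<epsilon> * L2norm2 T (\<lambda>t. f t - \<gamma> *\<^sub>R p t) \<le> J (\<lambda>t. \<gamma> *\<^sub>R p t)" if f: "f \<in> L2 T" for f
  proof -
    define g where "g t = f t + (- \<gamma>) *\<^sub>R p t" for t
    have g: "g \<in> L2 T"
      unfolding g_def by (intro L2_add f L2_continuous continuous_intros ham_continuous[OF h])
    obtain z where z: "continuous_on {0..T} z" "z 0 = 0" "ode_sol T (\<lambda>s. (A + G) *v z s + g s) z"
      by (rule volterra_ode[OF linear_vec L2_integrable[OF g]]) (use T_pos in auto)
    have g': "g = (\<lambda>t. f t - \<gamma> *\<^sub>R p t)"
      by (simp add: g_def fun_eq_iff)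
    have "J f = J (\<lambda>t. \<gamma> *\<^sub>R p t + g t)"
      by (simp add: g_def)
    also have "\<dots> = J (\<lambda>t. \<gamma> *\<^sub>R p t) - Jpp T Qhat H \<gamma> g z"
      by (rule ham_stationary[OF h g z(3,2)])
    finally show ?thesis
      using \<epsilon>(2)[OF g z(3,2)] unfolding g' by simp
  qed
  with \<epsilon>(1) show thesis
    by (rule that)
qed

text \<open>Each of \<gamma> p and \<gamma> p' beats the other by a positive multiple of their
  squared distance, so this distance is zero, and continuity gives p = p' everywhere on [0,T]. Both
  triples are then states for the same disturbance.\<close>

lemma ham_unique:
  assumes H1: "H1 T A G Gam Q H \<gamma>" and h: "ham x m p" and h': "ham x' m' p'"
  shows "\<And>t. t \<in> {0..T} \<Longrightarrow> p' t = p t" "\<And>t. t \<in> {0..T} \<Longrightarrow> m' t = m t"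
    "AE \<omega> in M. \<forall>t\<in>{0..T}. x' t \<omega> = x t \<omega>"
proof -
  obtain \<epsilon> where \<epsilon>: "\<epsilon> > 0"
    "\<And>f. f \<in> L2 T \<Longrightarrow> J f + \<epsilon> * L2norm2 T (\<lambda>t. f t - \<gamma> *\<^sub>R p t) \<le> J (\<lambda>t. \<gamma> *\<^sub>R p t)"
    using ham_strict_maximizer[OF H1 h] by blast
  obtain \<epsilon>' where \<epsilon>': "\<epsilon>' > 0"
    "\<And>f. f \<in> L2 T \<Longrightarrow> J f + \<epsilon>' * L2norm2 T (\<lambda>t. f t - \<gamma> *\<^sub>R p' t) \<le> J (\<lambda>t. \<gamma> *\<^sub>R p' t)"
    using ham_strict_maximizer[OF H1 h'] by blast
  have "0 \<le> \<epsilon>' * L2norm2 T (\<lambda>t. \<gamma> *\<^sub>R p t - \<gamma> *\<^sub>R p' t)"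
    using \<epsilon>'(1) by (simp add: L2norm2_nonneg)
  then have "\<epsilon> * L2norm2 T (\<lambda>t. \<gamma> *\<^sub>R p' t - \<gamma> *\<^sub>R p t) \<le> 0"
    using \<epsilon>(2)[OF ham_L2[OF h']] \<epsilon>'(2)[OF ham_L2[OF h]] by linarith
  then have "L2norm2 T (\<lambda>t. \<gamma> *\<^sub>R p' t - \<gamma> *\<^sub>R p t) = 0"
    using \<epsilon>(1) L2norm2_nonneg[of "\<lambda>t. \<gamma> *\<^sub>R p' t - \<gamma> *\<^sub>R p t"] by (simp add: mult_le_0_iff)
  then have "(\<integral>t. (norm (\<gamma> *\<^sub>R p' t - \<gamma> *\<^sub>R p t))\<^sup>2 \<partial>leb T) = 0"
    unfolding L2norm2_def LINT_leb .
  moreover have "continuous_on {0..T} (\<lambda>t. \<gamma> *\<^sub>R p' t - \<gamma> *\<^sub>R p t)"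
    by (intro continuous_intros ham_continuous[OF h] ham_continuous[OF h'])
  ultimately have pp: "\<gamma> *\<^sub>R p' t - \<gamma> *\<^sub>R p t = 0" if "t \<in> {0..T}" for t
    using continuous_zero_of_square_integral[OF _ T_pos _ that] by blast
  then show "p' t = p t" if "t \<in> {0..T}" for t
    using that gam by (simp add: pp flip: scaleR_diff_right)
  have "state (\<lambda>t. \<gamma> *\<^sub>R p t) x' m'"
    by (rule state_cong[OF hamD(1)[OF h']]) (use pp in simp)
  note uniq = state_unique[OF hamD(1)[OF h] this]
  show "\<And>t. t \<in> {0..T} \<Longrightarrow> m' t = m t" "AE \<omega> in M. \<forall>t\<in>{0..T}. x' t \<omega> = x t \<omega>"
    by (rule uniq, assumption, rule uniq)
qed

end

theorem theorem4:
  fixes M :: "'a measure" and W :: "real \<Rightarrow> 'a \<Rightarrow> real^'n2" and T :: real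
    and A G Gam Q H :: "real^'n^'n" and B :: "real^'n1^'n" and D :: "real^'n2^'n"
    and R :: "real^'n1^'n1" and \<eta> m0 x0 :: "real^'n" and \<gamma> :: real
    and u :: "real \<Rightarrow> 'a \<Rightarrow> real^'n1" and ubar :: "real \<Rightarrow> real^'n1"
  assumes BM: "std_BM M W"
    and T: "T > 0" and gam: "\<gamma> > 0"
    and Q: "transpose Q = Q" "\<forall>v. 0 \<le> v \<bullet> (Q *v v)"
    and H: "transpose H = H" "\<forall>v. 0 \<le> v \<bullet> (H *v v)"
    and R: "transpose R = R" "\<forall>v. v \<noteq> 0 \<longrightarrow> 0 < v \<bullet> (R *v v)"
    and hyp1: "H1 T A G Gam Q H \<gamma>"
    and u: "L2F M W T u"
    and ubar: "continuous_on {0..T} ubar"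
  shows "\<exists>fh \<in> L2 T.
           (\<forall>f\<in>L2 T. Jbar M W T A B G D Gam Q H R \<eta> \<gamma> x0 m0 u ubar f
                        \<le> Jbar M W T A B G D Gam Q H R \<eta> \<gamma> x0 m0 u ubar fh) \<and>
           (\<forall>g\<in>L2 T. (\<forall>f\<in>L2 T. Jbar M W T A B G D Gam Q H R \<eta> \<gamma> x0 m0 u ubar f
                                 \<le> Jbar M W T A B G D Gam Q H R \<eta> \<gamma> x0 m0 u ubar g)
                      \<longrightarrow> (AE t in lborel. t \<in> {0..T} \<longrightarrow> g t = fh t)) \<and>
           (\<exists>x m p. ham_sol M W T A B G D Gam Q H \<eta> \<gamma> x0 m0 u ubar x m p \<and>
              (\<forall>x' m' p'. ham_sol M W T A B G D Gam Q H \<eta> \<gamma> x0 m0 u ubar x' m' p' \<longrightarrow>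
                  (\<forall>t\<in>{0..T}. m' t = m t \<and> p' t = p t) \<and>
                  (AE \<omega> in M. \<forall>t\<in>{0..T}. x' t \<omega> = x t \<omega>)) \<and>
              (AE t in lborel. t \<in> {0..T} \<longrightarrow> fh t = \<gamma> *\<^sub>R p t))"
proof -
  interpret control M W T A G Gam Q H B D R \<eta> m0 x0 \<gamma> u ubar
    by unfold_locales (fact BM T gam Q(1) H(1) u ubar)+
  obtain x m p where h: "ham x m p"
    by (rule ham_exists[OF hyp1])
  define fh where "fh t = \<gamma> *\<^sub>R p t" for t
  have fh: "fh \<in> L2 T"
    unfolding fh_def by (rule ham_L2[OF h])
  obtain \<epsilon> where \<epsilon>: "\<epsilon> > 0" "\<And>f. f \<in> L2 T \<Longrightarrow> J f + \<epsilon> * L2norm2 T (\<lambda>t. f t - fh t) \<le> J fh"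
    unfolding fh_def using ham_strict_maximizer[OF hyp1 h] by blast
  have pos: "0 \<le> \<epsilon> * L2norm2 T (\<lambda>t. f t - fh t)" for f
    using \<epsilon>(1) by (simp add: L2norm2_nonneg)
  have max: "J f \<le> J fh" if "f \<in> L2 T" for f
    using \<epsilon>(2)[OF that] pos[of f] by linarith
  have uniq: "AE t in lborel. t \<in> {0..T} \<longrightarrow> g t = fh t"
    if g: "g \<in> L2 T" and "\<forall>f\<in>L2 T. J f \<le> J g" for g
  proof -
    have "J fh \<le> J g"
      using that(2) fh by blast
    then have "\<epsilon> * L2norm2 T (\<lambda>t. g t - fh t) \<le> 0"
      using \<epsilon>(2)[OF g] by linarith
    then have "L2norm2 T (\<lambda>t. g t - fh t) = 0"
      using \<epsilon>(1) L2norm2_nonneg[of "\<lambda>t. g t - fh t"] by (simp add: mult_le_0_iff)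
    then have 0: "(\<integral>t. (norm (g t - fh t))\<^sup>2 \<partial>leb T) = 0"
      unfolding L2norm2_def LINT_leb .
    have "(\<lambda>t. g t + (- 1) *\<^sub>R fh t) \<in> L2 T"
      by (intro L2_add g L2_bounded_linear[OF fh] linear_scale_self)
    then have "integrable (leb T) (\<lambda>t. (norm (g t - fh t))\<^sup>2)"
      using L2_square by fastforce
    \<comment> \<open>A competing maximizer is merely square integrable, so zero distance gives
      equality almost everywhere.\<close>
    then have "AE t in leb T. (norm (g t - fh t))\<^sup>2 = 0"
      using 0 by (subst (asm) integral_nonneg_eq_0_iff_AE) simp_all
    then show ?thesis
      by (subst (asm) AE_restrict_space_iff) simp_all
  qed
  show ?thesis
  proof (rule bexI[OF _ fh], intro conjI)
    show "\<forall>f\<in>L2 T. J f \<le> J fh"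
      using max by blast
    show "\<forall>g\<in>L2 T. (\<forall>f\<in>L2 T. J f \<le> J g) \<longrightarrow> (AE t in lborel. t \<in> {0..T} \<longrightarrow> g t = fh t)"
      using uniq by blast
    show "\<exists>x m p. ham x m p \<and>
        (\<forall>x' m' p'. ham x' m' p' \<longrightarrow> (\<forall>t\<in>{0..T}. m' t = m t \<and> p' t = p t) \<and>
          (AE \<omega> in M. \<forall>t\<in>{0..T}. x' t \<omega> = x t \<omega>)) \<and>
        (AE t in lborel. t \<in> {0..T} \<longrightarrow> fh t = \<gamma> *\<^sub>R p t)"
    proof (rule exI[of _ x], rule exI[of _ m], rule exI[of _ p], intro conjI allI impI ballI)
      show "AE t in lborel. t \<in> {0..T} \<longrightarrow> fh t = \<gamma> *\<^sub>R p t"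
        by (simp add: fh_def)
    qed (rule h | rule ham_unique[OF hyp1 h]; assumption)+
  qed
qed

end
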